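(* Let $p$ be a prime and let $L/K$ be a Galois extension of fields with Galois group $\Gamma$ an elementary abelian $p$-group of order $p^n$. Suppose $L/K$ has a Hopf Galois structure by an abelian $K$-Hopf algebra $H$ of type $G$, where $G$ is an elementary abelian $p$-group (written additively). Let $A=(G,+,\cdot)$ be a nilpotent ring structure on $(G,+)$ yielding the regular subgroup $T\cong(G,\circ)$ of $\mathrm{Hol}(G)$ corresponding to $H$, where $(G,\circ)\cong\Gamma$. Then the following are equivalent: (i) the $H$-Hopf Galois structure on $L/K$ satisfies the strong form of the Fundamental Theorem of Galois Theory; (ii) $A$ is the trivial nilpotent algebra, satisfying $A^2=0$; (iii) $T=\rho(G)$; (iv) $H$ is the classical Galois structure by $K[\Gamma]$ on $L/K$.
   Context: Hopf Galois structures. For a finite-dimensional cocommutative $K$-Hopf algebra $H$ with counit $\epsilon$, a finite extension $L/K$ is $H$-Hopf Galois if $L$ is an $H$-module algebra and the $K$-linear map $L\otimes_K H\to\mathrm{End}_K(L)$, $x\otimes h\mapsto(y\mapsto x\,(hy))$, is bijective. For a $K$-sub-Hopf algebra $J$ of $H$ put $\mathcal F(J)=L^J=\{x\in L: hx=\epsilon(h)x\ \text{for all } h\in J\}$. By Chase–Sweedler, $\mathcal F$ is an injection from the $K$-sub-Hopf algebras of $H$ to the intermediate fields $K\subseteq E\subseteq L$. The strong form of the Fundamental Theorem of Galois Theory holds for the $H$-Hopf Galois structure if $\mathcal F$ is also surjective. The classical Galois structure is $H=K[\Gamma]$ with its natural action on $L$. Regular subgroups and type. $\mathrm{Perm}(X)$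 is the permutation group of $X$; a subgroup is regular if it acts simply transitively; a regular embedding is an injective homomorphism with regular image. $\lambda$ and $\rho$ denote left and right regular representations ($\lambda(\gamma)(\delta)=\gamma\delta$, $\rho(\gamma)(\delta)=\delta\gamma^{-1}$). By Greither–Pareigis, the Hopf Galois structures on $L/K$ correspond bijectively to regular subgroups $N$ of $\mathrm{Perm}(\Gamma)$ normalized by $\lambda(\Gamma)$: $N$ corresponds to $H=L[N]^\Gamma$, where $\Gamma$ acts on $L$ as Galois group and on $N$ by conjugation via $\lambda$, with action on $L$ given by $(\sum_{\eta} s_\eta\eta)x=\sum_\eta s_\eta\,\eta^{-1}(1_\Gamma)(x)$; then $L\otimes_K H\cong L[N]$. $H$ has type $G$ if $N=\alpha(G)$ for an injective homomorphism $\alpha:G\to\mathrm{Perm}(\Gamma)$. Correspondence with $T$ and $A$. $\mathrm{Hol}(G)=\rho(G)\cdot\mathrm{Aut}(G)$ is the normalizer of $\lambda(G)$ in $\mathrm{Perm}(G)$. A nilpotent ring structure on $(G,+)$ means a commutative, associative, nilpotent (non-unital) ring $A=(G,+,\cdot)$; put $g\circ h=g+h+g\cdot h$, which makes $G$ an abelian group $(G,\circ)$. It yields the regular subgroup $T=\tau(G)\subset\mathrm{Hol}(G)$, where $\tau(g)(x)=g\circ x$. Given an isomorphism $\xi:\Gamma\to(G,\circ)$, the map $\beta=\tau\xi:\Gamma\to\mathrm{Hol}(G)$ is a regular embedding with image $T$; the corresponding regular embedding $\alpha:(G,+)\to\mathrm{Perm}(\Gamma)$ is $\alpha(g)(\gamma)=\xi^{-1}(g+\xi(\gamma))$,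 whose image is normalized by $\lambda(\Gamma)$. To say that $A$ and $T$ correspond to $H$ means that, for some such $\xi$, $H$ is the Hopf algebra (with its action on $L$) corresponding to $N=\alpha(G)$. *)

theory Defs
  imports Complex_Main "HOL-Algebra.Bij" "HOL-Algebra.Coset" "HOL-Computational_Algebra.Primes"
begin

section \<open>Tensor products of vector spaces\<close>

text \<open>
  The library has no tensor product.  An element of \<open>V \<otimes> W\<close> is represented by a list
  \<open>[(v\<^sub>1, w\<^sub>1), \<dots>, (v\<^sub>r, w\<^sub>r)]\<close> standing for the sum of the \<open>v\<^sub>i \<otimes> w\<^sub>i\<close>; concatenation is
  addition.  Two lists denote the same tensor iff they are related by the least congruence on
  formal sums that contains the bilinearity relations, so that the quotient is the usual
  presentation of the tensor product.  (Negatives exist in the quotient because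
  \<open>(v, w) + (- v, w)\<close> is identified with \<open>(0, w)\<close>, that is, with the empty sum.)
\<close>

inductive formal_sum_cong :: "('x list \<Rightarrow> 'x list \<Rightarrow> bool) \<Rightarrow> 'x list \<Rightarrow> 'x list \<Rightarrow> bool"
  for R :: "'x list \<Rightarrow> 'x list \<Rightarrow> bool" where
  base: "R xs ys \<Longrightarrow> formal_sum_cong R xs ys"
| refl: "formal_sum_cong R xs xs"
| sym: "formal_sum_cong R xs ys \<Longrightarrow> formal_sum_cong R ys xs"
| trans: "formal_sum_cong R xs ys \<Longrightarrow> formal_sum_cong R ys zs \<Longrightarrow> formal_sum_cong R xs zs"
| append: "formal_sum_cong R xs ys \<Longrightarrow> formal_sum_cong R us vs \<Longrightarrow>
    formal_sum_cong R (xs @ us) (ys @ vs)"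
| comm: "formal_sum_cong R (xs @ ys) (ys @ xs)"

inductive bilinear_rel ::
  "('k \<Rightarrow> 'v \<Rightarrow> 'v) \<Rightarrow> ('k \<Rightarrow> 'w \<Rightarrow> 'w) \<Rightarrow>
   ('v::ab_group_add \<times> 'w::ab_group_add) list \<Rightarrow> ('v \<times> 'w) list \<Rightarrow> bool"
  for sV :: "'k \<Rightarrow> 'v \<Rightarrow> 'v" and sW :: "'k \<Rightarrow> 'w \<Rightarrow> 'w" where
  zero: "bilinear_rel sV sW [(0, w)] []"
| add1: "bilinear_rel sV sW [(v + v', w)] [(v, w), (v', w)]"
| add2: "bilinear_rel sV sW [(v, w + w')] [(v, w), (v, w')]"
| balanced: "bilinear_rel sV sW [(sV c v, w)] [(v, sW c w)]"

definition tensor_eq ::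
  "('k \<Rightarrow> 'v \<Rightarrow> 'v) \<Rightarrow> ('k \<Rightarrow> 'w \<Rightarrow> 'w) \<Rightarrow>
   ('v::ab_group_add \<times> 'w::ab_group_add) list \<Rightarrow> ('v \<times> 'w) list \<Rightarrow> bool" where
  "tensor_eq sV sW = formal_sum_cong (bilinear_rel sV sW)"

inductive trilinear_rel ::
  "('k \<Rightarrow> 'v \<Rightarrow> 'v) \<Rightarrow> ('v::ab_group_add \<times> 'v \<times> 'v) list \<Rightarrow> ('v \<times> 'v \<times> 'v) list \<Rightarrow> bool"
  for sV :: "'k \<Rightarrow> 'v \<Rightarrow> 'v" where
  zero: "trilinear_rel sV [(0, v, w)] []"
| add1: "trilinear_rel sV [(u + u', v, w)] [(u, v, w), (u', v, w)]"
| add2: "trilinear_rel sV [(u, v + v', w)] [(u, v, w), (u, v', w)]"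
| add3: "trilinear_rel sV [(u, v, w + w')] [(u, v, w), (u, v, w')]"
| balanced12: "trilinear_rel sV [(sV c u, v, w)] [(u, sV c v, w)]"
| balanced23: "trilinear_rel sV [(u, sV c v, w)] [(u, v, sV c w)]"

definition tensor3_eq ::
  "('k \<Rightarrow> 'v \<Rightarrow> 'v) \<Rightarrow> ('v::ab_group_add \<times> 'v \<times> 'v) list \<Rightarrow> ('v \<times> 'v \<times> 'v) list \<Rightarrow> bool" where
  "tensor3_eq sV = formal_sum_cong (trilinear_rel sV)"


section \<open>Hopf algebras\<close>

text \<open>
  The comultiplication is given in Sweedler form: \<open>\<Delta> x\<close> is a list of pairs representing the
  tensor \<open>\<Delta>(x)\<close>.  Only the class of \<open>\<Delta> x\<close> modulo \<open>tensor_eq\<close> is relevant.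
\<close>

locale hopf_algebra = vector_space scale
  for scale :: "'k::field \<Rightarrow> 'h::ring_1 \<Rightarrow> 'h" +
  fixes \<Delta> :: "'h \<Rightarrow> ('h \<times> 'h) list"
    and \<epsilon> :: "'h \<Rightarrow> 'k"
    and S :: "'h \<Rightarrow> 'h"
  assumes scale_mult_left: "scale c x * y = scale c (x * y)"
    and scale_mult_right: "x * scale c y = scale c (x * y)"
    and comult_add: "tensor_eq scale scale (\<Delta> (x + y)) (\<Delta> x @ \<Delta> y)"
    and comult_scale: "tensor_eq scale scale (\<Delta> (scale c x)) [(scale c a, b). (a, b) \<leftarrow> \<Delta> x]"
    and comult_one: "tensor_eq scale scale (\<Delta> 1) [(1, 1)]"
    and comult_mult:
      "tensor_eq scale scale (\<Delta> (x * y)) [(a * c, b * d). (a, b) \<leftarrow> \<Delta> x, (c, d) \<leftarrow> \<Delta> y]"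
    and counit_add: "\<epsilon> (x + y) = \<epsilon> x + \<epsilon> y"
    and counit_scale: "\<epsilon> (scale c x) = c * \<epsilon> x"
    and counit_one: "\<epsilon> 1 = 1"
    and counit_mult: "\<epsilon> (x * y) = \<epsilon> x * \<epsilon> y"
    and coassoc:
      "tensor3_eq scale
         [(a\<^sub>1, a\<^sub>2, b). (a, b) \<leftarrow> \<Delta> x, (a\<^sub>1, a\<^sub>2) \<leftarrow> \<Delta> a]
         [(a, b\<^sub>1, b\<^sub>2). (a, b) \<leftarrow> \<Delta> x, (b\<^sub>1, b\<^sub>2) \<leftarrow> \<Delta> b]"
    and counit_left: "(\<Sum>(a, b)\<leftarrow>\<Delta> x. scale (\<epsilon> a) b) = x"
    and counit_right: "(\<Sum>(a, b)\<leftarrow>\<Delta> x. scale (\<epsilon> b) a) = x"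
    and antipode_add: "S (x + y) = S x + S y"
    and antipode_scale: "S (scale c x) = scale c (S x)"
    and antipode_left: "(\<Sum>(a, b)\<leftarrow>\<Delta> x. S a * b) = scale (\<epsilon> x) 1"
    and antipode_right: "(\<Sum>(a, b)\<leftarrow>\<Delta> x. a * S b) = scale (\<epsilon> x) 1"

definition cocommutative :: "('k \<Rightarrow> 'h \<Rightarrow> 'h) \<Rightarrow> ('h::ring_1 \<Rightarrow> ('h \<times> 'h) list) \<Rightarrow> bool" where
  "cocommutative scale \<Delta> \<longleftrightarrow> (\<forall>x. tensor_eq scale scale (\<Delta> x) [(b, a). (a, b) \<leftarrow> \<Delta> x])"

definition fin_dim :: "('k::field \<Rightarrow> 'v::ab_group_add \<Rightarrow> 'v) \<Rightarrow> bool" where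
  "fin_dim scale \<longleftrightarrow> (\<exists>B. finite B \<and> module.span scale B = UNIV)"

text \<open>
  The comultiplication of \<open>h \<in> J\<close> must lie in \<open>J \<otimes> J\<close>, viewed inside \<open>H \<otimes> H\<close> (over a field
  \<open>J \<otimes> J \<longrightarrow> H \<otimes> H\<close> is injective): it must have a representation with all entries in \<open>J\<close>.
\<close>

definition sub_hopf_algebra ::
  "('k::field \<Rightarrow> 'h \<Rightarrow> 'h) \<Rightarrow> ('h::ring_1 \<Rightarrow> ('h \<times> 'h) list) \<Rightarrow> ('h \<Rightarrow> 'h) \<Rightarrow> 'h set \<Rightarrow> bool" where
  "sub_hopf_algebra scale \<Delta> S J \<longleftrightarrow>
     module.subspace scale J \<and> 1 \<in> J \<and> (\<forall>x\<in>J. \<forall>y\<in>J. x * y \<in> J) \<and> (\<forall>x\<in>J. S x \<in> J) \<and>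
     (\<forall>x\<in>J. \<exists>zs. set zs \<subseteq> J \<times> J \<and> tensor_eq scale scale (\<Delta> x) zs)"


section \<open>Field extensions\<close>

text \<open>An extension \<open>L/K\<close> is given by a homomorphism \<open>\<iota>\<close> from the field \<open>K\<close> to the field \<open>L\<close>.\<close>

definition field_ext :: "('k::field \<Rightarrow> 'l::field) \<Rightarrow> bool" where
  "field_ext \<iota> \<longleftrightarrow>
     \<iota> 1 = 1 \<and> (\<forall>x y. \<iota> (x + y) = \<iota> x + \<iota> y) \<and> (\<forall>x y. \<iota> (x * y) = \<iota> x * \<iota> y)"

definition ext_scale :: "('k::field \<Rightarrow> 'l::field) \<Rightarrow> 'k \<Rightarrow> 'l \<Rightarrow> 'l" where
  "ext_scale \<iota> c x = \<iota> c * x"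

definition intermediate_field :: "('k::field \<Rightarrow> 'l::field) \<Rightarrow> 'l set \<Rightarrow> bool" where
  "intermediate_field \<iota> E \<longleftrightarrow>
     range \<iota> \<subseteq> E \<and> (\<forall>x\<in>E. \<forall>y\<in>E. x - y \<in> E \<and> x * y \<in> E) \<and> (\<forall>x\<in>E. inverse x \<in> E)"

definition gal_group :: "('k::field \<Rightarrow> 'l::field) \<Rightarrow> ('l \<Rightarrow> 'l) monoid" where
  "gal_group \<iota> =
     \<lparr>carrier = {\<sigma>. bij \<sigma> \<and> (\<forall>x y. \<sigma> (x + y) = \<sigma> x + \<sigma> y) \<and> (\<forall>x y. \<sigma> (x * y) = \<sigma> x * \<sigma> y) \<and>
                    (\<forall>c. \<sigma> (\<iota> c) = \<iota> c)},
      monoid.mult = (\<circ>), one = id\<rparr>"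

definition finite_galois_ext :: "('k::field \<Rightarrow> 'l::field) \<Rightarrow> bool" where
  "finite_galois_ext \<iota> \<longleftrightarrow>
     field_ext \<iota> \<and> fin_dim (ext_scale \<iota>) \<and>
     {x. \<forall>\<sigma>\<in>carrier (gal_group \<iota>). \<sigma> x = x} = range \<iota>"


section \<open>Hopf Galois structures\<close>

definition module_algebra ::
  "('k::field \<Rightarrow> 'l::field) \<Rightarrow> ('k \<Rightarrow> 'h \<Rightarrow> 'h) \<Rightarrow> ('h::ring_1 \<Rightarrow> ('h \<times> 'h) list) \<Rightarrow> ('h \<Rightarrow> 'k) \<Rightarrow>
   ('h \<Rightarrow> 'l \<Rightarrow> 'l) \<Rightarrow> bool" where
  "module_algebra \<iota> scale \<Delta> \<epsilon> act \<longleftrightarrow>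
     (\<forall>h x y. act h (x + y) = act h x + act h y) \<and>
     (\<forall>g h x. act (g + h) x = act g x + act h x) \<and>
     (\<forall>c h x. act (scale c h) x = \<iota> c * act h x) \<and>
     (\<forall>c h x. act h (\<iota> c * x) = \<iota> c * act h x) \<and>
     (\<forall>x. act 1 x = x) \<and>
     (\<forall>g h x. act (g * h) x = act g (act h x)) \<and>
     (\<forall>h x y. act h (x * y) = (\<Sum>(a, b)\<leftarrow>\<Delta> h. act a x * act b y)) \<and>
     (\<forall>h. act h 1 = \<iota> (\<epsilon> h))"

text \<open>The map from \<open>L \<otimes> H\<close> to \<open>End\<^sub>K(L)\<close> sending \<open>x \<otimes> h\<close> to \<open>y \<mapsto> x (h y)\<close>, on formal sums.\<close>

definition galois_map :: "('h \<Rightarrow> 'l \<Rightarrow> 'l) \<Rightarrow> ('l \<times> 'h) list \<Rightarrow> 'l::field \<Rightarrow> 'l" where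
  "galois_map act xs = (\<lambda>y. \<Sum>(x, h)\<leftarrow>xs. x * act h y)"

definition hopf_galois ::
  "('k::field \<Rightarrow> 'l::field) \<Rightarrow> ('k \<Rightarrow> 'h \<Rightarrow> 'h) \<Rightarrow> ('h::ring_1 \<Rightarrow> ('h \<times> 'h) list) \<Rightarrow> ('h \<Rightarrow> 'k) \<Rightarrow>
   ('h \<Rightarrow> 'h) \<Rightarrow> ('h \<Rightarrow> 'l \<Rightarrow> 'l) \<Rightarrow> bool" where
  "hopf_galois \<iota> scale \<Delta> \<epsilon> S act \<longleftrightarrow>
     hopf_algebra scale \<Delta> \<epsilon> S \<and> fin_dim scale \<and> cocommutative scale \<Delta> \<and>
     module_algebra \<iota> scale \<Delta> \<epsilon> act \<and>
     (\<forall>xs ys. galois_map act xs = galois_map act ys \<longrightarrow> tensor_eq (ext_scale \<iota>) scale xs ys) \<and>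
     (\<forall>f. Vector_Spaces.linear (ext_scale \<iota>) (ext_scale \<iota>) f \<longrightarrow> (\<exists>xs. galois_map act xs = f))"

definition fixed_by ::
  "('k::field \<Rightarrow> 'l::field) \<Rightarrow> ('h \<Rightarrow> 'k) \<Rightarrow> ('h \<Rightarrow> 'l \<Rightarrow> 'l) \<Rightarrow> 'h set \<Rightarrow> 'l set" where
  "fixed_by \<iota> \<epsilon> act J = {x. \<forall>h\<in>J. act h x = \<iota> (\<epsilon> h) * x}"

definition strong_FTGT ::
  "('k::field \<Rightarrow> 'l::field) \<Rightarrow> ('k \<Rightarrow> 'h \<Rightarrow> 'h) \<Rightarrow> ('h::ring_1 \<Rightarrow> ('h \<times> 'h) list) \<Rightarrow> ('h \<Rightarrow> 'k) \<Rightarrow>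
   ('h \<Rightarrow> 'h) \<Rightarrow> ('h \<Rightarrow> 'l \<Rightarrow> 'l) \<Rightarrow> bool" where
  "strong_FTGT \<iota> scale \<Delta> \<epsilon> S act \<longleftrightarrow>
     (\<forall>E. intermediate_field \<iota> E \<longrightarrow>
        (\<exists>J. sub_hopf_algebra scale \<Delta> S J \<and> fixed_by \<iota> \<epsilon> act J = E))"


section \<open>Group algebras\<close>

text \<open>
  For a finite group \<open>M\<close>, the group algebra \<open>F[M]\<close> consists of the functions \<open>M \<rightarrow> F\<close>, extended
  by zero; \<open>f\<close> stands for the sum of the \<open>f(m) m\<close>.
\<close>

definition group_algebra :: "'m monoid \<Rightarrow> ('m \<Rightarrow> 'f::field) set" where
  "group_algebra M = {f. \<forall>m. m \<notin> carrier M \<longrightarrow> f m = 0}"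

definition ga_one :: "'m monoid \<Rightarrow> 'm \<Rightarrow> 'f::field" where
  "ga_one M = (\<lambda>m. if m = \<one>\<^bsub>M\<^esub> then 1 else 0)"

definition ga_mult :: "'m monoid \<Rightarrow> ('m \<Rightarrow> 'f) \<Rightarrow> ('m \<Rightarrow> 'f) \<Rightarrow> 'm \<Rightarrow> 'f::field" where
  "ga_mult M f g =
     (\<lambda>z. \<Sum>(x, y)\<in>{(x, y). x \<in> carrier M \<and> y \<in> carrier M \<and> x \<otimes>\<^bsub>M\<^esub> y = z}. f x * g y)"

text \<open>
  \<open>\<phi>\<close> is an isomorphism of \<open>K\<close>-Hopf algebras from \<open>H\<close> onto \<open>C\<close>, where \<open>C\<close> is a \<open>K\<close>-form of the
  group algebra \<open>F[M]\<close>, that is, a \<open>K\<close>-subspace with \<open>F \<otimes>\<^sub>K C = F[M]\<close> whose structure is inherited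
  from \<open>F[M]\<close> (\<open>\<iota>\<close> is the embedding of \<open>K\<close> into \<open>F\<close>).  In \<open>F[M]\<close> the elements of \<open>M\<close> are
  grouplike: \<open>\<Delta>(m) = m \<otimes> m\<close>, \<open>\<epsilon>(m) = 1\<close>, \<open>S(m) = m\<^sup>-\<^sup>1\<close>.  Since \<open>C \<otimes>\<^sub>K C\<close> embeds into
  \<open>F[M] \<otimes>\<^sub>F F[M]\<close>, which has the basis \<open>m \<otimes> m'\<close>, the condition \<open>(\<phi> \<otimes> \<phi>) \<circ> \<Delta> = \<Delta> \<circ> \<phi>\<close> is
  expressed by comparing coefficients at \<open>m \<otimes> m'\<close>.
\<close>

definition hopf_iso_onto ::
  "('k::field \<Rightarrow> 'f::field) \<Rightarrow> ('k \<Rightarrow> 'h \<Rightarrow> 'h) \<Rightarrow> ('h::ring_1 \<Rightarrow> ('h \<times> 'h) list) \<Rightarrow> ('h \<Rightarrow> 'k) \<Rightarrow>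
   ('h \<Rightarrow> 'h) \<Rightarrow> 'm monoid \<Rightarrow> ('m \<Rightarrow> 'f) set \<Rightarrow> ('h \<Rightarrow> 'm \<Rightarrow> 'f) \<Rightarrow> bool" where
  "hopf_iso_onto \<iota> scale \<Delta> \<epsilon> S M C \<phi> \<longleftrightarrow>
     bij_betw \<phi> UNIV C \<and>
     (\<forall>x y m. \<phi> (x + y) m = \<phi> x m + \<phi> y m) \<and>
     (\<forall>c x m. \<phi> (scale c x) m = \<iota> c * \<phi> x m) \<and>
     \<phi> 1 = ga_one M \<and>
     (\<forall>x y. \<phi> (x * y) = ga_mult M (\<phi> x) (\<phi> y)) \<and>
     (\<forall>x. \<forall>m\<in>carrier M. \<forall>m'\<in>carrier M.
        (\<Sum>(a, b)\<leftarrow>\<Delta> x. \<phi> a m * \<phi> b m') = (if m = m' then \<phi> x m else 0)) \<and>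
     (\<forall>x. \<iota> (\<epsilon> x) = (\<Sum>m\<in>carrier M. \<phi> x m)) \<and>
     (\<forall>x. \<forall>m\<in>carrier M. \<phi> (S x) m = \<phi> x (inv\<^bsub>M\<^esub> m))"


section \<open>Regular subgroups and the Greither-Pareigis correspondence\<close>

definition left_reg :: "'m monoid \<Rightarrow> 'm \<Rightarrow> 'm \<Rightarrow> 'm" where
  "left_reg M g = (\<lambda>x\<in>carrier M. g \<otimes>\<^bsub>M\<^esub> x)"

definition right_reg :: "'m monoid \<Rightarrow> 'm \<Rightarrow> 'm \<Rightarrow> 'm" where
  "right_reg M g = (\<lambda>x\<in>carrier M. x \<otimes>\<^bsub>M\<^esub> inv\<^bsub>M\<^esub> g)"

definition regular_subgroup :: "'x set \<Rightarrow> ('x \<Rightarrow> 'x) set \<Rightarrow> bool" where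
  "regular_subgroup X N \<longleftrightarrow>
     subgroup N (BijGroup X) \<and> (\<forall>x\<in>X. \<forall>y\<in>X. \<exists>!\<eta>. \<eta> \<in> N \<and> \<eta> x = y)"

definition conj_left :: "'m monoid \<Rightarrow> 'm \<Rightarrow> ('m \<Rightarrow> 'm) \<Rightarrow> ('m \<Rightarrow> 'm)" where
  "conj_left \<Gamma> \<gamma> \<eta> =
     left_reg \<Gamma> \<gamma> \<otimes>\<^bsub>BijGroup (carrier \<Gamma>)\<^esub> \<eta>
       \<otimes>\<^bsub>BijGroup (carrier \<Gamma>)\<^esub> inv\<^bsub>BijGroup (carrier \<Gamma>)\<^esub> (left_reg \<Gamma> \<gamma>)"

definition normalized_by_left :: "'m monoid \<Rightarrow> ('m \<Rightarrow> 'm) set \<Rightarrow> bool" where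
  "normalized_by_left \<Gamma> N \<longleftrightarrow> (\<forall>\<gamma>\<in>carrier \<Gamma>. conj_left \<Gamma> \<gamma> ` N = N)"

definition subgroup_monoid :: "'m monoid \<Rightarrow> ('m \<Rightarrow> 'm) set \<Rightarrow> ('m \<Rightarrow> 'm) monoid" where
  "subgroup_monoid \<Gamma> N = (BijGroup (carrier \<Gamma>))\<lparr>carrier := N\<rparr>"

text \<open>
  \<open>L[N]\<^sup>\<Gamma>\<close>: here \<open>\<gamma>\<close> sends the sum of the \<open>f(\<eta>) \<eta>\<close> to the sum of the \<open>\<gamma>(f(\<eta>)) (\<lambda>(\<gamma>) \<eta> \<lambda>(\<gamma>)\<^sup>-\<^sup>1)\<close>,
  so invariance says that the coefficient at the conjugate of \<open>\<eta>\<close> is \<open>\<gamma>(f(\<eta>))\<close>.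
\<close>

definition fixed_group_algebra ::
  "('k::field \<Rightarrow> 'l::field) \<Rightarrow> (('l \<Rightarrow> 'l) \<Rightarrow> ('l \<Rightarrow> 'l)) set \<Rightarrow> ((('l \<Rightarrow> 'l) \<Rightarrow> ('l \<Rightarrow> 'l)) \<Rightarrow> 'l) set" where
  "fixed_group_algebra \<iota> N =
     {f \<in> group_algebra (subgroup_monoid (gal_group \<iota>) N).
        \<forall>\<gamma>\<in>carrier (gal_group \<iota>). \<forall>\<eta>\<in>N. f (conj_left (gal_group \<iota>) \<gamma> \<eta>) = \<gamma> (f \<eta>)}"

text \<open>\<open>H\<close>, with its action on \<open>L\<close>, is the Hopf algebra \<open>L[N]\<^sup>\<Gamma>\<close> corresponding to \<open>N\<close>.\<close>

definition corresponds_to_subgroup ::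
  "('k::field \<Rightarrow> 'l::field) \<Rightarrow> ('k \<Rightarrow> 'h \<Rightarrow> 'h) \<Rightarrow> ('h::ring_1 \<Rightarrow> ('h \<times> 'h) list) \<Rightarrow> ('h \<Rightarrow> 'k) \<Rightarrow>
   ('h \<Rightarrow> 'h) \<Rightarrow> ('h \<Rightarrow> 'l \<Rightarrow> 'l) \<Rightarrow> (('l \<Rightarrow> 'l) \<Rightarrow> ('l \<Rightarrow> 'l)) set \<Rightarrow> bool" where
  "corresponds_to_subgroup \<iota> scale \<Delta> \<epsilon> S act N \<longleftrightarrow>
     regular_subgroup (carrier (gal_group \<iota>)) N \<and> normalized_by_left (gal_group \<iota>) N \<and>
     (\<exists>\<phi>. hopf_iso_onto \<iota> scale \<Delta> \<epsilon> S (subgroup_monoid (gal_group \<iota>) N)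
             (fixed_group_algebra \<iota> N) \<phi> \<and>
          (\<forall>h x. act h x =
             (\<Sum>\<eta>\<in>N. \<phi> h \<eta> * (inv\<^bsub>BijGroup (carrier (gal_group \<iota>))\<^esub> \<eta>) \<one>\<^bsub>gal_group \<iota>\<^esub> x)))"

definition has_type ::
  "('k::field \<Rightarrow> 'l::field) \<Rightarrow> ('k \<Rightarrow> 'h \<Rightarrow> 'h) \<Rightarrow> ('h::ring_1 \<Rightarrow> ('h \<times> 'h) list) \<Rightarrow> ('h \<Rightarrow> 'k) \<Rightarrow>
   ('h \<Rightarrow> 'h) \<Rightarrow> ('h \<Rightarrow> 'l \<Rightarrow> 'l) \<Rightarrow> 'g monoid \<Rightarrow> bool" where
  "has_type \<iota> scale \<Delta> \<epsilon> S act G \<longleftrightarrow>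
     (\<exists>\<alpha>. \<alpha> \<in> hom G (BijGroup (carrier (gal_group \<iota>))) \<and> inj_on \<alpha> (carrier G) \<and>
          corresponds_to_subgroup \<iota> scale \<Delta> \<epsilon> S act (\<alpha> ` carrier G))"

definition classical_structure ::
  "('k::field \<Rightarrow> 'l::field) \<Rightarrow> ('k \<Rightarrow> 'h \<Rightarrow> 'h) \<Rightarrow> ('h::ring_1 \<Rightarrow> ('h \<times> 'h) list) \<Rightarrow> ('h \<Rightarrow> 'k) \<Rightarrow>
   ('h \<Rightarrow> 'h) \<Rightarrow> ('h \<Rightarrow> 'l \<Rightarrow> 'l) \<Rightarrow> bool" where
  "classical_structure \<iota> scale \<Delta> \<epsilon> S act \<longleftrightarrow>
     (\<exists>\<phi>. hopf_iso_onto (\<lambda>c. c) scale \<Delta> \<epsilon> S (gal_group \<iota>) (group_algebra (gal_group \<iota>)) \<phi> \<and>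
          (\<forall>h x. act h x = (\<Sum>\<gamma>\<in>carrier (gal_group \<iota>). \<iota> (\<phi> h \<gamma>) * \<gamma> x)))"


section \<open>Nilpotent ring structures\<close>

text \<open>
  The class \<open>comm_ring\<close> is that of commutative, associative rings not assumed to have a unit.  A
  type of this class is a ring \<open>A\<close>, and its additive group is \<open>(G,+)\<close>.
\<close>

definition ring_set_prod :: "'a::comm_ring set \<Rightarrow> 'a set \<Rightarrow> 'a set" where
  "ring_set_prod I J = {\<Sum>(a, b)\<leftarrow>ps. a * b | ps. set ps \<subseteq> I \<times> J}"

text \<open>The power \<open>A\<^sup>n\<close> for \<open>n \<ge> 1\<close>; the value at \<open>0\<close> is \<open>A\<close> by convention.\<close>

definition ring_pow :: "nat \<Rightarrow> 'a::comm_ring set" where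
  "ring_pow n = (ring_set_prod UNIV ^^ (n - 1)) UNIV"

definition nilpotent_ring :: "'a::comm_ring itself \<Rightarrow> bool" where
  "nilpotent_ring _ \<longleftrightarrow> (\<exists>n\<ge>1. (ring_pow n :: 'a set) = {0})"

definition additive_group :: "'a::ab_group_add monoid" where
  "additive_group = \<lparr>carrier = UNIV, monoid.mult = (+), one = 0\<rparr>"

definition circle_group :: "'a::comm_ring monoid" where
  "circle_group = \<lparr>carrier = UNIV, monoid.mult = (\<lambda>g h. g + h + g * h), one = 0\<rparr>"

definition elementary_abelian :: "nat \<Rightarrow> 'm monoid \<Rightarrow> bool" where
  "elementary_abelian p M \<longleftrightarrow>
     comm_group M \<and> finite (carrier M) \<and> (\<forall>x\<in>carrier M. x [^]\<^bsub>M\<^esub> p = \<one>\<^bsub>M\<^esub>)"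

definition ring_regular_subgroup :: "('a::comm_ring \<Rightarrow> 'a) set" where
  "ring_regular_subgroup = left_reg circle_group ` carrier circle_group"

definition perm_embedding :: "'m monoid \<Rightarrow> ('m \<Rightarrow> 'a::comm_ring) \<Rightarrow> 'a \<Rightarrow> 'm \<Rightarrow> 'm" where
  "perm_embedding \<Gamma> \<xi> g = (\<lambda>\<gamma>\<in>carrier \<Gamma>. inv_into (carrier \<Gamma>) \<xi> (g + \<xi> \<gamma>))"

definition corresponds_to_ring ::
  "('k::field \<Rightarrow> 'l::field) \<Rightarrow> ('k \<Rightarrow> 'h \<Rightarrow> 'h) \<Rightarrow> ('h::ring_1 \<Rightarrow> ('h \<times> 'h) list) \<Rightarrow> ('h \<Rightarrow> 'k) \<Rightarrow>
   ('h \<Rightarrow> 'h) \<Rightarrow> ('h \<Rightarrow> 'l \<Rightarrow> 'l) \<Rightarrow> 'a::comm_ring itself \<Rightarrow> bool" where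
  "corresponds_to_ring \<iota> scale \<Delta> \<epsilon> S act _ \<longleftrightarrow>
     (\<exists>\<xi> \<in> iso (gal_group \<iota>) (circle_group :: 'a monoid).
        corresponds_to_subgroup \<iota> scale \<Delta> \<epsilon> S act (range (perm_embedding (gal_group \<iota>) \<xi>)))"

end

theory Submission
  imports Defs "HOL-Algebra.Multiplicative_Group"
begin

text \<open>
Write \<open>\<theta>\<close> for the inverse of the isomorphism \<open>\<xi>\<close> from \<open>\<Gamma>\<close> to \<open>(A, \<circ>)\<close>.  The whole argument takes
  place in coordinates: the elements of \<open>H = L[N]\<^sup>\<Gamma>\<close> are the functions \<open>f\<close> from \<open>A\<close> to \<open>L\<close>, where
  \<open>f g\<close> is the coefficient at the permutation \<open>\<alpha>(g)\<close>.  Conjugation by \<open>\<lambda>(\<gamma>)\<close> sends \<open>\<alpha>(g)\<close> to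
  \<open>\<alpha>(g + \<xi>(\<gamma>) g)\<close> (\<open>conj_alpha\<close>), so the functions that occur are those with
  \<open>f (g + \<xi>(\<gamma>) g) = \<gamma> (f g)\<close>, and \<open>\<alpha>(g)\<close> acts on \<open>L\<close> as the automorphism \<open>\<theta>(- g)\<close>.

  Strong form implies \<open>A\<^sup>2 = 0\<close>.  For a sub-Hopf algebra \<open>J\<close> let \<open>I\<close> be the set of all \<open>g\<close> at which
  some element of \<open>J\<close> has a nonzero coefficient.  Because the \<open>\<alpha>(g)\<close> are grouplike, the \<open>L\<close>-span of
  \<open>J\<close> contains \<open>\<alpha>(g)\<close> for every \<open>g \<in> I\<close> (\<open>support_delta\<close>).  Hence \<open>I\<close> is closed under addition, it
  is closed under multiplication by \<open>A\<close> because of the equivariance, and \<open>J\<close> has the same fixed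
  field as the subgroup \<open>\<theta>(I)\<close> of \<open>\<Gamma>\<close> (\<open>fixed_by_sub_hopf_algebra\<close>).  If every intermediate field
  arises in this way, then every subgroup of \<open>(A, \<circ>)\<close> is an ideal of \<open>A\<close>, since distinct
  subgroups of \<open>\<Gamma>\<close> have distinct fixed fields.  In particular the cyclic \<open>\<circ>\<close>-subgroup generated by
  an element \<open>x\<close> is an ideal with at most \<open>p\<close> elements.  If \<open>a x \<noteq> 0\<close>, then \<open>a x\<close> generates this ideal
  additively, so that \<open>x\<close> is a multiple of \<open>a x\<close>, that is, \<open>x = b x\<close> for some \<open>b \<in> A\<close>; in a nilpotent
  ring this forces \<open>x = 0\<close>.

  The other implications.  If \<open>A\<^sup>2 = 0\<close>, then conjugation is trivial on \<open>N\<close>, all coefficients lie in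
  \<open>K\<close>, and sending \<open>\<alpha>(g)\<close> to \<open>\<theta>(- g)\<close> identifies \<open>H\<close> with \<open>K[\<Gamma>]\<close>.  Conversely, if \<open>H\<close> acts on \<open>L\<close> as
  \<open>K[\<Gamma>]\<close> does, then by the independence of automorphisms each single \<open>\<alpha>(g)\<close> is an element of \<open>H\<close>;
  its equivariance says that \<open>\<xi>(\<gamma>) g = 0\<close> for all \<open>\<gamma>\<close>.  For the classical structure, an
  intermediate field \<open>E\<close> is the fixed field of the group algebra of its stabilizer, by classical
  Galois theory.  That \<open>T\<close> consists of the translations exactly when \<open>A\<^sup>2 = 0\<close> is a direct
  computation.

  The facts from Galois theory are obtained from one device, \<open>separating_sum\<close>, which expresses the
  indicator function of a stabilizer as a combination of evaluations.
\<close>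

section \<open>Galois theory from separating sums\<close>

locale galois_extension =
  fixes \<iota> :: "'k::field \<Rightarrow> 'l::field"
  assumes galois: "finite_galois_ext \<iota>"
    and finite_gal: "finite (carrier (gal_group \<iota>))"
begin

abbreviation "\<Gamma> \<equiv> gal_group \<iota>"

lemma
  assumes "\<sigma> \<in> carrier \<Gamma>"
  shows gal_bij: "bij \<sigma>" and gal_add: "\<sigma> (x + y) = \<sigma> x + \<sigma> y"
    and gal_mult: "\<sigma> (x * y) = \<sigma> x * \<sigma> y" and gal_base: "\<sigma> (\<iota> c) = \<iota> c"
  using assms by (auto simp: gal_group_def)

lemma
  assumes s: "\<sigma> \<in> carrier \<Gamma>"
  shows gal_zero: "\<sigma> 0 = 0" and gal_one: "\<sigma> 1 = 1"
    and gal_diff: "\<sigma> (x - y) = \<sigma> x - \<sigma> y"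
    and gal_inverse: "\<sigma> (inverse x) = inverse (\<sigma> x)"
    and gal_sum: "\<sigma> (sum f B) = (\<Sum>b\<in>B. \<sigma> (f b))"
    and gal_sum_list: "\<sigma> (sum_list (map h ys)) = (\<Sum>y\<leftarrow>ys. \<sigma> (h y))"
proof -
  show z: "\<sigma> 0 = 0" using gal_add[OF s, of 0 0] by (metis add_0_left add_cancel_left_left)
  have inj: "inj \<sigma>" using gal_bij[OF s] by (rule bij_is_inj)
  have n1: "\<sigma> 1 \<noteq> 0" using z inj by (metis injD zero_neq_one)
  show o: "\<sigma> 1 = 1" using gal_mult[OF s, of 1 1] n1 by simp
  have m: "\<sigma> (- x) = - \<sigma> x" for x
    using gal_add[OF s, of x "- x"] z by (simp add: minus_unique)
  show "\<sigma> (x - y) = \<sigma> x - \<sigma> y"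
    using gal_add[OF s, of x "- y"] m by simp
  show "\<sigma> (inverse x) = inverse (\<sigma> x)"
  proof (cases "x = 0")
    case False
    then have "\<sigma> x * \<sigma> (inverse x) = 1" using gal_mult[OF s, of x "inverse x"] o by simp
    then show ?thesis by (metis inverse_unique)
  qed (simp add: z)
  show "\<sigma> (sum f B) = (\<Sum>b\<in>B. \<sigma> (f b))"
    by (induction B rule: infinite_finite_induct) (auto simp: z gal_add[OF s])
  show "\<sigma> (sum_list (map h ys)) = (\<Sum>y\<leftarrow>ys. \<sigma> (h y))"
    by (induction ys) (auto simp: z gal_add[OF s])
qed

lemma gal_group_one: "\<one>\<^bsub>\<Gamma>\<^esub> = id" and gal_group_mult: "\<sigma> \<otimes>\<^bsub>\<Gamma>\<^esub> \<tau> = \<sigma> \<circ> \<tau>"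
  by (auto simp: gal_group_def)

lemma group_gal: "group \<Gamma>"
proof (rule groupI)
  fix \<sigma> assume s: "\<sigma> \<in> carrier \<Gamma>"
  have b: "bij \<sigma>" using gal_bij[OF s] .
  have e: "inv_into UNIV \<sigma> (\<sigma> x) = x" "\<sigma> (inv_into UNIV \<sigma> x) = x" for x
    using b by (simp_all add: bij_is_inj bij_is_surj surj_f_inv_f)
  have "inv_into UNIV \<sigma> \<in> carrier \<Gamma>"
    unfolding gal_group_def
    apply (simp add: bij_imp_bij_inv[OF b])
    by (metis e gal_add[OF s] gal_mult[OF s] gal_base[OF s])
  moreover have "inv_into UNIV \<sigma> \<circ> \<sigma> = id" using e by auto
  ultimately show "\<exists>\<tau>\<in>carrier \<Gamma>. \<tau> \<otimes>\<^bsub>\<Gamma>\<^esub> \<sigma> = \<one>\<^bsub>\<Gamma>\<^esub>"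
    unfolding gal_group_one gal_group_mult by blast
qed (auto simp: gal_group_def bij_comp)

lemma gal_inv_apply:
  assumes "\<sigma> \<in> carrier \<Gamma>"
  shows "(inv\<^bsub>\<Gamma>\<^esub> \<sigma>) (\<sigma> x) = x" "\<sigma> ((inv\<^bsub>\<Gamma>\<^esub> \<sigma>) x) = x"
  using group.l_inv[OF group_gal assms] group.r_inv[OF group_gal assms]
  unfolding gal_group_mult gal_group_one by (auto dest: fun_cong[of _ _ x])

lemma fixed_in_base: "(\<And>\<sigma>. \<sigma> \<in> carrier \<Gamma> \<Longrightarrow> \<sigma> x = x) \<Longrightarrow> x \<in> range \<iota>"
  using galois unfolding finite_galois_ext_def by blast

lemma
  shows base_one: "\<iota> 1 = 1" and base_add: "\<iota> (c + d) = \<iota> c + \<iota> d"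
    and base_mult: "\<iota> (c * d) = \<iota> c * \<iota> d"
  using galois by (auto simp: finite_galois_ext_def field_ext_def)

lemma base_zero: "\<iota> 0 = 0" using base_add[of 0 0] by (metis add_0_left add_cancel_left_left)

lemma base_sum: "\<iota> (sum f B) = (\<Sum>b\<in>B. \<iota> (f b))"
    by (induction B rule: infinite_finite_induct) (auto simp: base_zero base_add)

lemma base_sum_list: "\<iota> (sum_list (map h ys)) = (\<Sum>y\<leftarrow>ys. \<iota> (h y))"
  by (induction ys) (auto simp: base_zero base_add)

lemma base_inj: "\<iota> c = \<iota> d \<longleftrightarrow> c = d"
proof
  assume e: "\<iota> c = \<iota> d"
  have "\<iota> (c - d) = 0" using base_add[of "c - d" d] e by simp
  then have "c - d = 0" using base_mult[of "c - d" "inverse (c - d)"] base_one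
    by (metis mult_zero_left right_inverse zero_neq_one)
  then show "c = d" by simp
qed simp

definition pointwise_stabilizer :: "'l set \<Rightarrow> ('l \<Rightarrow> 'l) set" where
  "pointwise_stabilizer E = {\<sigma> \<in> carrier \<Gamma>. \<forall>e\<in>E. \<sigma> e = e}"

definition fixed_field :: "('l \<Rightarrow> 'l) set \<Rightarrow> 'l set" where
  "fixed_field D = {x. \<forall>\<sigma>\<in>D. \<sigma> x = x}"

text \<open>
  For each \<open>\<gamma>\<close> outside the stabilizer choose \<open>e \<in> E\<close> with \<open>\<gamma> e \<noteq> e\<close>.  The product of the factors
  \<open>(\<sigma> e - \<gamma> e) / (e - \<gamma> e)\<close> over all these \<open>\<gamma>\<close>, as a function of \<open>\<sigma>\<close>, is the indicator function of
  the stabilizer.  Since \<open>\<sigma>\<close> is multiplicative, expanding the product gives a sum of terms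
  \<open>c \<sigma>(e)\<close> with \<open>e \<in> E\<close>.
\<close>

lemma separating_sum:
  assumes one: "1 \<in> E" and mult: "\<And>x y. x \<in> E \<Longrightarrow> y \<in> E \<Longrightarrow> x * y \<in> E"
  obtains cs where "set cs \<subseteq> UNIV \<times> E"
    and "\<And>\<sigma>. \<sigma> \<in> carrier \<Gamma> \<Longrightarrow>
      (\<Sum>(c, e)\<leftarrow>cs. c * \<sigma> e) = (if \<sigma> \<in> pointwise_stabilizer E then 1 else 0)"
proof -
  let ?D = "pointwise_stabilizer E"
  let ?s = "\<lambda>cs \<sigma>. \<Sum>(c, e)\<leftarrow>cs. c * \<sigma> e"
  have "\<exists>cs. set cs \<subseteq> UNIV \<times> E \<and> (\<forall>\<sigma>\<in>?D. ?s cs \<sigma> = 1) \<and> (\<forall>\<sigma>\<in>B. ?s cs \<sigma> = 0)"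
    if "finite B" "B \<subseteq> carrier \<Gamma> - ?D" for B
    using that
  proof (induction B)
    case empty
    show ?case
      by (rule exI[of _ "[(1, 1)]"]) (auto simp: one gal_one pointwise_stabilizer_def)
  next
    case (insert \<gamma> B)
    then obtain cs where cs: "set cs \<subseteq> UNIV \<times> E" "\<forall>\<sigma>\<in>?D. ?s cs \<sigma> = 1" "\<forall>\<sigma>\<in>B. ?s cs \<sigma> = 0"
      by auto
    from insert obtain e where e: "e \<in> E" "\<gamma> e \<noteq> e"
      by (auto simp: pointwise_stabilizer_def)
    define d where "d = e - \<gamma> e"
    have d: "d \<noteq> 0" using e by (simp add: d_def)
    \<comment> \<open>The old sum multiplied by the factor \<open>(\<sigma> e - \<gamma> e) / d\<close>.\<close>
    define cs' where "cs' = map (\<lambda>(c, x). (c / d, x * e)) cs @ map (\<lambda>(c, x). (- (c * \<gamma> e / d), x)) cs"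
    have s: "?s cs' \<sigma> = (\<sigma> e - \<gamma> e) / d * ?s cs \<sigma>" if "\<sigma> \<in> carrier \<Gamma>" for \<sigma>
      unfolding cs'_def using gal_mult[OF that] d
      by (induction cs) (auto simp: field_simps)
    have "\<forall>\<sigma>\<in>?D. ?s cs' \<sigma> = 1"
      using cs(2) s d e(1) by (auto simp: pointwise_stabilizer_def d_def)
    moreover have "\<forall>\<sigma>\<in>insert \<gamma> B. ?s cs' \<sigma> = 0"
      using cs(3) s insert.prems by auto
    moreover have "set cs' \<subseteq> UNIV \<times> E"
      using cs(1) mult e(1) by (auto simp: cs'_def)
    ultimately show ?case by blast
  qed
  from this[of "carrier \<Gamma> - ?D"] finite_gal obtain cs where
    "set cs \<subseteq> UNIV \<times> E" "\<forall>\<sigma>\<in>?D. ?s cs \<sigma> = 1" "\<forall>\<sigma>\<in>carrier \<Gamma> - ?D. ?s cs \<sigma> = 0" by auto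
  then show ?thesis using that[of cs] by auto
qed

text \<open>
  Dedekind's lemma: with \<open>E = L\<close>, \<open>separating_sum\<close> gives evaluations whose combination picks out
  the coefficient at the identity; translating by \<open>\<tau>\<close> picks out the coefficient at \<open>\<tau>\<close>.
\<close>

lemma linear_independence_of_automorphisms:
  assumes z: "\<And>x. (\<Sum>\<sigma>\<in>carrier \<Gamma>. a \<sigma> * \<sigma> x) = 0" and t: "\<tau> \<in> carrier \<Gamma>"
  shows "a \<tau> = 0"
proof -
  interpret G: group \<Gamma> by (rule group_gal)
  obtain cs where cs: "\<And>\<sigma>. \<sigma> \<in> carrier \<Gamma> \<Longrightarrow>
      (\<Sum>(c, e)\<leftarrow>cs. c * \<sigma> e) = (if \<sigma> \<in> pointwise_stabilizer UNIV then 1 else 0)"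
    using separating_sum[of UNIV] by auto
  have D: "\<sigma> \<in> pointwise_stabilizer UNIV \<longleftrightarrow> \<sigma> = \<one>\<^bsub>\<Gamma>\<^esub>" if "\<sigma> \<in> carrier \<Gamma>" for \<sigma>
    using that by (auto simp: pointwise_stabilizer_def gal_group_one)
  have delta: "(\<Sum>(c, e)\<leftarrow>cs. \<tau> c * \<sigma> e) = (if \<sigma> = \<tau> then 1 else 0)" if s: "\<sigma> \<in> carrier \<Gamma>" for \<sigma>
  proof -
    have "(\<Sum>(c, e)\<leftarrow>cs. \<tau> c * \<sigma> e) = \<tau> (\<Sum>(c, e)\<leftarrow>cs. c * (inv\<^bsub>\<Gamma>\<^esub> \<tau> \<otimes>\<^bsub>\<Gamma>\<^esub> \<sigma>) e)"
      by (simp add: gal_sum_list[OF t] gal_mult[OF t] gal_group_mult gal_inv_apply[OF t] case_prod_unfold)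
    also have "\<dots> = (if inv\<^bsub>\<Gamma>\<^esub> \<tau> \<otimes>\<^bsub>\<Gamma>\<^esub> \<sigma> = \<one>\<^bsub>\<Gamma>\<^esub> then 1 else 0)"
      using cs[of "inv\<^bsub>\<Gamma>\<^esub> \<tau> \<otimes>\<^bsub>\<Gamma>\<^esub> \<sigma>"] D[of "inv\<^bsub>\<Gamma>\<^esub> \<tau> \<otimes>\<^bsub>\<Gamma>\<^esub> \<sigma>"] s t
      by (simp add: gal_one gal_zero)
    also have "inv\<^bsub>\<Gamma>\<^esub> \<tau> \<otimes>\<^bsub>\<Gamma>\<^esub> \<sigma> = \<one>\<^bsub>\<Gamma>\<^esub> \<longleftrightarrow> \<sigma> = \<tau>"
      using G.inv_solve_left[of "\<one>\<^bsub>\<Gamma>\<^esub>" \<tau> \<sigma>] s t by auto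
    finally show ?thesis .
  qed
  have "0 = (\<Sum>(c, e)\<leftarrow>cs. \<tau> c * (\<Sum>\<sigma>\<in>carrier \<Gamma>. a \<sigma> * \<sigma> e))"
    by (simp add: z case_prod_unfold)
  also have "\<dots> = (\<Sum>\<sigma>\<in>carrier \<Gamma>. a \<sigma> * (\<Sum>(c, e)\<leftarrow>cs. \<tau> c * \<sigma> e))"
    by (induction cs) (auto simp: sum_distrib_left algebra_simps sum.distrib)
  also have "\<dots> = (\<Sum>\<sigma>\<in>carrier \<Gamma>. if \<sigma> = \<tau> then a \<sigma> else 0)"
  proof (intro sum.cong HOL.refl)
    fix \<sigma> assume "\<sigma> \<in> carrier \<Gamma>"
    from delta[OF this] show "a \<sigma> * (\<Sum>(c, e)\<leftarrow>cs. \<tau> c * \<sigma> e) = (if \<sigma> = \<tau> then a \<sigma> else 0)" by simp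
  qed
  also have "\<dots> = a \<tau>" using t finite_gal by simp
  finally show ?thesis by simp
qed

lemma trace_in_base: "(\<Sum>\<sigma>\<in>carrier \<Gamma>. \<sigma> z) \<in> range \<iota>"
proof (rule fixed_in_base)
  interpret G: group \<Gamma> by (rule group_gal)
  fix \<tau> assume t: "\<tau> \<in> carrier \<Gamma>"
  have "\<tau> (\<Sum>\<sigma>\<in>carrier \<Gamma>. \<sigma> z) = (\<Sum>\<sigma>\<in>carrier \<Gamma>. (\<tau> \<otimes>\<^bsub>\<Gamma>\<^esub> \<sigma>) z)"
    by (simp add: gal_sum[OF t] gal_group_mult)
  also have "\<dots> = (\<Sum>\<sigma>\<in>(\<lambda>\<sigma>. \<tau> \<otimes>\<^bsub>\<Gamma>\<^esub> \<sigma>) ` carrier \<Gamma>. \<sigma> z)"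
    by (subst sum.reindex) (auto simp: G.inj_on_cmult t)
  also have "(\<lambda>\<sigma>. \<tau> \<otimes>\<^bsub>\<Gamma>\<^esub> \<sigma>) ` carrier \<Gamma> = carrier \<Gamma>"
    using t by (rule G.surj_const_mult)
  finally show "\<tau> (\<Sum>\<sigma>\<in>carrier \<Gamma>. \<sigma> z) = (\<Sum>\<sigma>\<in>carrier \<Gamma>. \<sigma> z)" .
qed

lemma subgroup_stabilizer: "subgroup (pointwise_stabilizer E) \<Gamma>"
proof (rule group.subgroupI[OF group_gal])
  interpret G: group \<Gamma> by (rule group_gal)
  show "pointwise_stabilizer E \<subseteq> carrier \<Gamma>" by (auto simp: pointwise_stabilizer_def)
  have "\<one>\<^bsub>\<Gamma>\<^esub> \<in> pointwise_stabilizer E" 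
    using G.one_closed by (simp add: pointwise_stabilizer_def gal_group_one)
  then show "pointwise_stabilizer E \<noteq> {}" by blast
  show "inv\<^bsub>\<Gamma>\<^esub> \<sigma> \<in> pointwise_stabilizer E" if "\<sigma> \<in> pointwise_stabilizer E" for \<sigma>
  proof -
    have f: "\<sigma> e = e" if "e \<in> E" for e
      using that \<open>\<sigma> \<in> pointwise_stabilizer E\<close> by (auto simp: pointwise_stabilizer_def)
    have s: "\<sigma> \<in> carrier \<Gamma>"
      using \<open>\<sigma> \<in> pointwise_stabilizer E\<close> by (simp add: pointwise_stabilizer_def)
    have "(inv\<^bsub>\<Gamma>\<^esub> \<sigma>) e = e" if "e \<in> E" for e
      using gal_inv_apply(1)[OF s, of e] f[OF that] by simp
    with s show ?thesis by (simp add: pointwise_stabilizer_def)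
  qed
  show "\<sigma> \<otimes>\<^bsub>\<Gamma>\<^esub> \<tau> \<in> pointwise_stabilizer E"
    if "\<sigma> \<in> pointwise_stabilizer E" "\<tau> \<in> pointwise_stabilizer E" for \<sigma> \<tau>
    using that G.m_closed unfolding pointwise_stabilizer_def by (auto simp: gal_group_mult)
qed

lemma sum_over_indicator:
  assumes "D \<subseteq> carrier \<Gamma>"
  shows "(\<Sum>\<sigma>\<in>carrier \<Gamma>. (if \<sigma> \<in> D then 1 else 0) * \<sigma> z) = (\<Sum>\<sigma>\<in>D. \<sigma> z)"
proof -
  have "(\<Sum>\<sigma>\<in>carrier \<Gamma>. (if \<sigma> \<in> D then 1 else 0) * \<sigma> z) = (\<Sum>\<sigma>\<in>carrier \<Gamma>. if \<sigma> \<in> D then \<sigma> z else 0)"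
    by (intro sum.cong) auto
  also have "\<dots> = (\<Sum>\<sigma>\<in>D. \<sigma> z)"
    using sum.inter_restrict[OF finite_gal, of "\<lambda>\<sigma>. \<sigma> z" D] assms by (simp add: inf.absorb2)
  finally show ?thesis .
qed

text \<open>
  Let \<open>D\<close> be the stabilizer of \<open>E\<close> and \<open>t(z)\<close> the sum of the \<open>\<sigma> z\<close> over \<open>\<sigma> \<in> D\<close>.  Inserting the
  separating sum of \<open>E\<close> for the indicator function of \<open>D\<close> writes \<open>t(z)\<close> as a combination of elements
  of \<open>E\<close> whose coefficients are traces of \<open>L/K\<close>, hence in \<open>K\<close>; so \<open>t(z) \<in> E\<close>.  An element \<open>y\<close> fixed by
  \<open>D\<close> satisfies \<open>t(y z) = y t(z)\<close>, and dividing by some nonzero \<open>t(z)\<close> gives \<open>y \<in> E\<close>.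
\<close>

theorem fixed_field_stabilizer:
  assumes E: "intermediate_field \<iota> E"
  shows "fixed_field (pointwise_stabilizer E) = E"
proof
  interpret G: group \<Gamma> by (rule group_gal)
  let ?D = "pointwise_stabilizer E"
  let ?tr = "\<lambda>z. \<Sum>\<sigma>\<in>?D. \<sigma> z"
  have K: "\<iota> c \<in> E" and diff: "x \<in> E \<Longrightarrow> y \<in> E \<Longrightarrow> x - y \<in> E"
    and mult: "x \<in> E \<Longrightarrow> y \<in> E \<Longrightarrow> x * y \<in> E" and inverse: "x \<in> E \<Longrightarrow> inverse x \<in> E" for c x y
    using E by (auto simp: intermediate_field_def)
  have zero: "0 \<in> E" using K[of 0] by (simp add: base_zero)
  have add: "x + y \<in> E" if "x \<in> E" "y \<in> E" for x y
    using diff[OF that(1) diff[OF zero that(2)]] by simp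
  have D: "?D \<subseteq> carrier \<Gamma>" by (auto simp: pointwise_stabilizer_def)
  obtain cs where cs: "set cs \<subseteq> UNIV \<times> E" "\<And>\<sigma>. \<sigma> \<in> carrier \<Gamma> \<Longrightarrow>
      (\<Sum>(c, e)\<leftarrow>cs. c * \<sigma> e) = (if \<sigma> \<in> ?D then 1 else 0)"
    using separating_sum[of E] K[of 1] mult by (auto simp: base_one)
  \<comment> \<open>Replacing \<open>\<sigma>\<close> by its inverse and applying \<open>\<sigma>\<close> moves the automorphism from \<open>e\<close> to \<open>c\<close>.\<close>
  have dual: "(\<Sum>(c, e)\<leftarrow>cs. \<sigma> c * e) = (if \<sigma> \<in> ?D then 1 else 0)" if s: "\<sigma> \<in> carrier \<Gamma>" for \<sigma>
  proof -
    have "(\<Sum>(c, e)\<leftarrow>cs. \<sigma> c * e) = \<sigma> (\<Sum>(c, e)\<leftarrow>cs. c * (inv\<^bsub>\<Gamma>\<^esub> \<sigma>) e)"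
      by (simp add: gal_sum_list[OF s] gal_mult[OF s] gal_inv_apply[OF s] case_prod_unfold)
    also have "\<dots> = (if inv\<^bsub>\<Gamma>\<^esub> \<sigma> \<in> ?D then 1 else 0)"
      using cs(2)[of "inv\<^bsub>\<Gamma>\<^esub> \<sigma>"] s by (simp add: gal_one gal_zero)
    also have "inv\<^bsub>\<Gamma>\<^esub> \<sigma> \<in> ?D \<longleftrightarrow> \<sigma> \<in> ?D"
      using s subgroup.m_inv_closed[OF subgroup_stabilizer[of E]] G.inv_inv[OF s] by metis
    finally show ?thesis .
  qed
  have tr: "?tr z \<in> E" for z
  proof -
    have "?tr z = (\<Sum>\<sigma>\<in>carrier \<Gamma>. (\<Sum>(c, e)\<leftarrow>cs. \<sigma> c * e) * \<sigma> z)"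
      unfolding sum_over_indicator[OF D, symmetric]
      by (intro sum.cong HOL.refl arg_cong2[of _ _ _ _ "(*)"] dual[symmetric])
    also have "\<dots> = (\<Sum>(c, e)\<leftarrow>cs. (\<Sum>\<sigma>\<in>carrier \<Gamma>. \<sigma> (c * z)) * e)"
      by (induction cs)
        (auto simp: sum_distrib_left sum_distrib_right algebra_simps sum.distrib gal_mult
          intro!: sum.cong)
    also have "\<dots> \<in> E"
      using cs(1)
    proof (induction cs)
      case (Cons a cs)
      moreover have "(\<Sum>\<sigma>\<in>carrier \<Gamma>. \<sigma> (fst a * z)) \<in> E"
        using trace_in_base[of "fst a * z"] K by fastforce
      ultimately show ?case by (auto intro!: add mult)
    qed (simp add: zero)
    finally show ?thesis .
  qed
  have "\<exists>z. ?tr z \<noteq> 0"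
  proof (rule ccontr)
    assume "\<not> ?thesis"
    then have "(\<Sum>\<sigma>\<in>carrier \<Gamma>. (if \<sigma> \<in> ?D then 1 else 0) * \<sigma> z) = 0" for z
      by (simp only: sum_over_indicator[OF D]) simp
    from linear_independence_of_automorphisms[OF this G.one_closed]
    show False using subgroup.one_closed[OF subgroup_stabilizer[of E]] by simp
  qed
  then obtain z where z: "?tr z \<noteq> 0" by blast
  show "fixed_field ?D \<subseteq> E"
  proof
    fix y assume y: "y \<in> fixed_field ?D"
    have "?tr (y * z) = y * ?tr z"
      using y D by (auto simp: sum_distrib_left fixed_field_def gal_mult subset_iff intro!: sum.cong)
    then have "y = ?tr (y * z) * inverse (?tr z)" using z by simp
    then show "y \<in> E" using mult tr inverse by metis
  qed
  show "E \<subseteq> fixed_field ?D" by (auto simp: fixed_field_def pointwise_stabilizer_def)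
qed

text \<open>
  An automorphism \<open>\<tau>\<close> that fixes the fixed field of \<open>D\<close> fixes all sums of the \<open>\<sigma> z\<close> over \<open>\<sigma> \<in> D\<close>.
  By linear independence, the coset \<open>\<tau> D\<close> is then equal to \<open>D\<close>.
\<close>

theorem stabilizer_fixed_field:
  assumes D: "subgroup D \<Gamma>"
  shows "pointwise_stabilizer (fixed_field D) = D"
proof
  interpret G: group \<Gamma> by (rule group_gal)
  interpret D: subgroup D \<Gamma> by (rule D)
  show "D \<subseteq> pointwise_stabilizer (fixed_field D)"
    by (auto simp: fixed_field_def pointwise_stabilizer_def)
  have shift: "(\<Sum>\<sigma>\<in>D. (\<tau> \<otimes>\<^bsub>\<Gamma>\<^esub> \<sigma>) z) = (\<Sum>\<sigma>\<in>(\<lambda>\<sigma>. \<tau> \<otimes>\<^bsub>\<Gamma>\<^esub> \<sigma>) ` D. \<sigma> z)" if "\<tau> \<in> carrier \<Gamma>" for \<tau> z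
    by (subst sum.reindex) (auto intro: inj_on_subset[OF G.inj_on_cmult[OF that] D.subset])
  have tr: "(\<Sum>\<sigma>\<in>D. \<sigma> z) \<in> fixed_field D" for z
  proof -
    have "\<tau> (\<Sum>\<sigma>\<in>D. \<sigma> z) = (\<Sum>\<sigma>\<in>D. \<sigma> z)" if t: "\<tau> \<in> D" for \<tau>
    proof -
      have t': "\<tau> \<in> carrier \<Gamma>" using t D.subset by blast
      have "x \<in> (\<lambda>\<sigma>. \<tau> \<otimes>\<^bsub>\<Gamma>\<^esub> \<sigma>) ` D" if x: "x \<in> D" for x
        using x t t' by (intro image_eqI[of _ _ "inv\<^bsub>\<Gamma>\<^esub> \<tau> \<otimes>\<^bsub>\<Gamma>\<^esub> x"]) (auto simp: G.m_assoc[symmetric])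
      then have "(\<lambda>\<sigma>. \<tau> \<otimes>\<^bsub>\<Gamma>\<^esub> \<sigma>) ` D = D" using t by auto
      then show ?thesis using shift[OF t'] by (simp add: gal_sum[OF t'] gal_group_mult)
    qed
    then show ?thesis by (simp add: fixed_field_def)
  qed
  show "pointwise_stabilizer (fixed_field D) \<subseteq> D"
  proof
    fix \<tau> assume "\<tau> \<in> pointwise_stabilizer (fixed_field D)"
    then have t: "\<tau> \<in> carrier \<Gamma>" and fix_tr: "\<tau> (\<Sum>\<sigma>\<in>D. \<sigma> z) = (\<Sum>\<sigma>\<in>D. \<sigma> z)" for z
      using tr by (auto simp: pointwise_stabilizer_def)
    let ?C = "(\<lambda>\<sigma>. \<tau> \<otimes>\<^bsub>\<Gamma>\<^esub> \<sigma>) ` D"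
    have C: "?C \<subseteq> carrier \<Gamma>" using t D.subset by auto
    have eq: "(\<Sum>\<sigma>\<in>?C. \<sigma> z) = (\<Sum>\<sigma>\<in>D. \<sigma> z)" for z
      using fix_tr[of z] shift[OF t, of z] by (simp add: gal_sum[OF t] gal_group_mult)
    have "(\<Sum>\<sigma>\<in>carrier \<Gamma>. ((if \<sigma> \<in> ?C then 1 else 0) - (if \<sigma> \<in> D then 1 else 0)) * \<sigma> z) = 0" for z
      by (simp only: left_diff_distrib sum_subtractf sum_over_indicator[OF C] sum_over_indicator[OF D.subset] eq)
        simp
    from linear_independence_of_automorphisms[OF this t]
    have "\<tau> \<in> ?C \<longleftrightarrow> \<tau> \<in> D" by (simp split: if_splits)
    moreover have "\<tau> \<in> ?C" using t by (intro image_eqI[of _ _ "\<one>\<^bsub>\<Gamma>\<^esub>"]) auto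
    ultimately show "\<tau> \<in> D" by blast
  qed
qed

lemma intermediate_fixed_field:
  assumes "D \<subseteq> carrier \<Gamma>"
  shows "intermediate_field \<iota> (fixed_field D)"
  unfolding intermediate_field_def fixed_field_def
  using assms by (auto simp: subset_iff gal_base gal_diff gal_mult gal_inverse)

end

section \<open>Coordinates of the Hopf algebra on the ring\<close>

locale circle_isomorphism = galois_extension \<iota>
  for \<iota> :: "'k::field \<Rightarrow> 'l::field" +
  fixes \<xi> :: "('l \<Rightarrow> 'l) \<Rightarrow> 'a::comm_ring"
  assumes iso: "\<xi> \<in> iso (gal_group \<iota>) circle_group"
begin

definition \<theta> :: "'a \<Rightarrow> 'l \<Rightarrow> 'l" where
  "\<theta> = inv_into (carrier \<Gamma>) \<xi>"

abbreviation "\<alpha> \<equiv> perm_embedding \<Gamma> \<xi>"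

lemma bij_xi: "bij_betw \<xi> (carrier \<Gamma>) UNIV"
  using iso by (simp add: iso_def circle_group_def)

lemma theta_in: "\<theta> g \<in> carrier \<Gamma>"
  unfolding \<theta>_def using bij_xi by (metis UNIV_I bij_betw_imp_surj_on inv_into_into)

lemma xi_theta [simp]: "\<xi> (\<theta> g) = g"
  unfolding \<theta>_def using bij_xi by (metis UNIV_I bij_betw_imp_surj_on f_inv_into_f)

lemma theta_xi: "\<gamma> \<in> carrier \<Gamma> \<Longrightarrow> \<theta> (\<xi> \<gamma>) = \<gamma>"
  unfolding \<theta>_def using bij_xi by (metis bij_betw_imp_inj_on inv_into_f_f)

lemma inj_theta: "inj \<theta>"
  by (metis injI xi_theta)

lemma xi_eq_iff: "\<gamma> \<in> carrier \<Gamma> \<Longrightarrow> \<delta> \<in> carrier \<Gamma> \<Longrightarrow> \<xi> \<gamma> = \<xi> \<delta> \<longleftrightarrow> \<gamma> = \<delta>"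
  using theta_xi by metis

lemma finite_ring: "finite (UNIV :: 'a set)"
  using bij_xi finite_gal bij_betw_finite by blast

lemma xi_mult:
  "\<gamma> \<in> carrier \<Gamma> \<Longrightarrow> \<delta> \<in> carrier \<Gamma> \<Longrightarrow> \<xi> (\<gamma> \<otimes>\<^bsub>\<Gamma>\<^esub> \<delta>) = \<xi> \<gamma> + \<xi> \<delta> + \<xi> \<gamma> * \<xi> \<delta>"
  using iso by (auto simp: iso_def hom_def circle_group_def)

lemma xi_one: "\<xi> \<one>\<^bsub>\<Gamma>\<^esub> = 0"
proof -
  interpret G: group \<Gamma> by (rule group_gal)
  have "\<xi> (\<one>\<^bsub>\<Gamma>\<^esub> \<otimes>\<^bsub>\<Gamma>\<^esub> \<theta> 0) = \<xi> \<one>\<^bsub>\<Gamma>\<^esub>"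
    by (simp only: xi_mult[OF G.one_closed theta_in] xi_theta) simp
  then show ?thesis by (simp add: theta_in)
qed

lemma alpha_apply: "\<gamma> \<in> carrier \<Gamma> \<Longrightarrow> \<alpha> g \<gamma> = \<theta> (g + \<xi> \<gamma>)"
  by (simp add: perm_embedding_def \<theta>_def)

lemma alpha_comp: "compose (carrier \<Gamma>) (\<alpha> g) (\<alpha> h) = \<alpha> (g + h)"
  by (rule extensionalityI[of _ "carrier \<Gamma>"])
    (auto simp: compose_def alpha_apply theta_in add.assoc, auto simp: perm_embedding_def)

lemma alpha_Bij: "\<alpha> g \<in> Bij (carrier \<Gamma>)"
proof -
  have "bij_betw (\<alpha> g) (carrier \<Gamma>) (carrier \<Gamma>)"
    by (rule bij_betw_byWitness[of _ "\<alpha> (- g)"]) (auto simp: alpha_apply theta_in theta_xi)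
  then show ?thesis by (simp add: Bij_def perm_embedding_def)
qed

lemma alpha_mult: "\<alpha> g \<otimes>\<^bsub>BijGroup (carrier \<Gamma>)\<^esub> \<alpha> h = \<alpha> (g + h)"
  using alpha_Bij alpha_comp by (simp add: BijGroup_def)

lemma alpha_zero: "\<alpha> 0 = \<one>\<^bsub>BijGroup (carrier \<Gamma>)\<^esub>"
  by (auto simp: BijGroup_def perm_embedding_def \<theta>_def[symmetric] theta_xi)

lemma alpha_inv: "inv\<^bsub>BijGroup (carrier \<Gamma>)\<^esub> (\<alpha> g) = \<alpha> (- g)"
  by (rule group.inv_equality[OF group_BijGroup])
    (simp_all add: alpha_mult alpha_zero alpha_Bij BijGroup_def[of "carrier \<Gamma>"] alpha_comp)

lemma alpha_at_one: "\<alpha> g \<one>\<^bsub>\<Gamma>\<^esub> = \<theta> g"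
  using alpha_apply[OF monoid.one_closed[OF group.is_monoid[OF group_gal]]] by (simp add: xi_one)

lemma inj_alpha: "inj \<alpha>"
  by (metis alpha_at_one injI xi_theta)

lemma left_reg_Bij:
  assumes "\<gamma> \<in> carrier \<Gamma>"
  shows "left_reg \<Gamma> \<gamma> \<in> Bij (carrier \<Gamma>)"
proof -
  interpret G: group \<Gamma> by (rule group_gal)
  have "bij_betw (left_reg \<Gamma> \<gamma>) (carrier \<Gamma>) (carrier \<Gamma>)"
    by (rule bij_betw_byWitness[of _ "left_reg \<Gamma> (inv\<^bsub>\<Gamma>\<^esub> \<gamma>)"])
      (auto simp: left_reg_def assms G.m_assoc[symmetric])
  then show ?thesis by (simp add: Bij_def left_reg_def)
qed

text \<open>
  In the circle group, \<open>c \<circ> (g + d) = (g + c g) + c \<circ> d\<close>; hence left translation by \<open>c = \<xi>(\<gamma>)\<close>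
  intertwines addition of \<open>g\<close> with addition of \<open>g + c g\<close>.
\<close>

lemma conj_alpha:
  assumes g: "\<gamma> \<in> carrier \<Gamma>"
  shows "conj_left \<Gamma> \<gamma> (\<alpha> g) = \<alpha> (g + \<xi> \<gamma> * g)"
proof -
  interpret G: group \<Gamma> by (rule group_gal)
  interpret B: group "BijGroup (carrier \<Gamma>)" by (rule group_BijGroup)
  have in_carrier: "left_reg \<Gamma> \<gamma> \<in> carrier (BijGroup (carrier \<Gamma>))"
    "\<And>h. \<alpha> h \<in> carrier (BijGroup (carrier \<Gamma>))"
    using left_reg_Bij[OF g] alpha_Bij by (auto simp: BijGroup_def)
  have "\<gamma> \<otimes>\<^bsub>\<Gamma>\<^esub> \<theta> (g + \<xi> \<delta>) = \<theta> (g + \<xi> \<gamma> * g + \<xi> (\<gamma> \<otimes>\<^bsub>\<Gamma>\<^esub> \<delta>))" if "\<delta> \<in> carrier \<Gamma>" for \<delta>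
    by (rule xi_eq_iff[OF G.m_closed[OF g theta_in] theta_in, THEN iffD1])
      (simp add: that g xi_mult theta_in algebra_simps)
  then have "compose (carrier \<Gamma>) (left_reg \<Gamma> \<gamma>) (\<alpha> g)
      = compose (carrier \<Gamma>) (\<alpha> (g + \<xi> \<gamma> * g)) (left_reg \<Gamma> \<gamma>)"
    using g by (auto simp: compose_def left_reg_def alpha_apply theta_in restrict_def)
  then have "left_reg \<Gamma> \<gamma> \<otimes>\<^bsub>BijGroup (carrier \<Gamma>)\<^esub> \<alpha> g
      = \<alpha> (g + \<xi> \<gamma> * g) \<otimes>\<^bsub>BijGroup (carrier \<Gamma>)\<^esub> left_reg \<Gamma> \<gamma>"
    using left_reg_Bij[OF g] alpha_Bij by (simp add: BijGroup_def)
  then show ?thesis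
    unfolding conj_left_def using in_carrier by (simp add: B.m_assoc)
qed

end

text \<open>
  The Hopf algebra \<open>L[N]\<^sup>\<Gamma>\<close> transported along \<open>\<alpha>\<close>: \<open>\<psi> x g\<close> is the coefficient of \<open>x\<close> at \<open>\<alpha>(g)\<close>.  By
  \<open>conj_alpha\<close>, invariance under \<open>\<Gamma>\<close> becomes the equivariance condition below, and the
  permutation \<open>\<alpha>(g)\<close> acts through \<open>\<alpha>(g)\<^sup>-\<^sup>1(1) = \<theta>(- g)\<close>.
\<close>

locale coordinates = circle_isomorphism \<iota> \<xi> + H: hopf_algebra scale \<Delta> \<epsilon> S
  for \<iota> :: "'k::field \<Rightarrow> 'l::field" and \<xi> :: "('l \<Rightarrow> 'l) \<Rightarrow> 'a::comm_ring"
    and scale :: "'k \<Rightarrow> 'h \<Rightarrow> 'h::ring_1" and \<Delta> \<epsilon> S +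
  fixes act :: "'h \<Rightarrow> 'l \<Rightarrow> 'l" and \<psi> :: "'h \<Rightarrow> 'a \<Rightarrow> 'l"
  assumes coord_inj: "\<psi> x = \<psi> y \<Longrightarrow> x = y"
    and coord_surj: "(\<And>\<gamma> g. \<gamma> \<in> carrier \<Gamma> \<Longrightarrow> f (g + \<xi> \<gamma> * g) = \<gamma> (f g)) \<Longrightarrow> \<exists>x. \<psi> x = f"
    and coord_equivariant: "\<gamma> \<in> carrier \<Gamma> \<Longrightarrow> \<psi> x (g + \<xi> \<gamma> * g) = \<gamma> (\<psi> x g)"
    and coord_add: "\<psi> (x + y) g = \<psi> x g + \<psi> y g"
    and coord_scale: "\<psi> (scale c x) g = \<iota> c * \<psi> x g"
    and coord_one: "\<psi> 1 g = (if g = 0 then 1 else 0)"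
    and coord_mult: "\<psi> (x * y) g = (\<Sum>u\<in>UNIV. \<psi> x u * \<psi> y (g - u))"
    and coord_comult: "(\<Sum>(a, b)\<leftarrow>\<Delta> x. \<psi> a g * \<psi> b h) = (if g = h then \<psi> x g else 0)"
    and coord_counit: "\<iota> (\<epsilon> x) = (\<Sum>g\<in>UNIV. \<psi> x g)"
    and coord_antipode: "\<psi> (S x) g = \<psi> x (- g)"
    and coord_act: "act x z = (\<Sum>g\<in>UNIV. \<psi> x g * \<theta> (- g) z)"

lemma (in circle_isomorphism) coordinates_of_correspondence:
  assumes H: "hopf_algebra scale \<Delta> \<epsilon> S"
    and corr: "corresponds_to_subgroup \<iota> scale \<Delta> \<epsilon> S act (range \<alpha>)"
  obtains \<psi> where "coordinates \<iota> \<xi> scale \<Delta> \<epsilon> S act \<psi>"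
proof -
  let ?N = "range \<alpha>"
  let ?M = "subgroup_monoid \<Gamma> ?N"
  interpret H: hopf_algebra scale \<Delta> \<epsilon> S by (rule H)
  interpret B: group "BijGroup (carrier \<Gamma>)" by (rule group_BijGroup)
  obtain \<phi> where \<phi>: "hopf_iso_onto \<iota> scale \<Delta> \<epsilon> S ?M (fixed_group_algebra \<iota> ?N) \<phi>"
    and act: "\<And>h x. act h x =
      (\<Sum>\<eta>\<in>?N. \<phi> h \<eta> * (inv\<^bsub>BijGroup (carrier \<Gamma>)\<^esub> \<eta>) \<one>\<^bsub>\<Gamma>\<^esub> x)"
    and regular: "regular_subgroup (carrier \<Gamma>) ?N"
    using corr unfolding corresponds_to_subgroup_def by blast
  have sub: "subgroup ?N (BijGroup (carrier \<Gamma>))" using regular by (simp add: regular_subgroup_def)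
  have M: "carrier ?M = ?N" "x \<otimes>\<^bsub>?M\<^esub> y = x \<otimes>\<^bsub>BijGroup (carrier \<Gamma>)\<^esub> y"
    "\<one>\<^bsub>?M\<^esub> = \<one>\<^bsub>BijGroup (carrier \<Gamma>)\<^esub>" for x y
    by (simp_all add: subgroup_monoid_def)
  have M_inv: "inv\<^bsub>?M\<^esub> (\<alpha> g) = \<alpha> (- g)" for g
    unfolding subgroup_monoid_def using B.m_inv_consistent[OF sub] alpha_inv by auto
  have bij: "bij_betw \<phi> UNIV (fixed_group_algebra \<iota> ?N)"
    using \<phi> by (simp add: hopf_iso_onto_def)
  then have mem: "\<phi> x \<in> fixed_group_algebra \<iota> ?N" for x by (auto simp: bij_betw_def)
  have sum_N: "(\<Sum>\<eta>\<in>?N. f \<eta>) = (\<Sum>g\<in>UNIV. f (\<alpha> g))" for f :: "_ \<Rightarrow> 'l"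
    using sum.reindex[OF inj_alpha, of f] by simp
  have comult: "(\<Sum>(a, b)\<leftarrow>\<Delta> x. \<phi> a m * \<phi> b m') = (if m = m' then \<phi> x m else 0)"
    if "m \<in> ?N" "m' \<in> ?N" for x m m'
    using \<phi> that unfolding hopf_iso_onto_def M by blast
  define \<psi> where "\<psi> x g = \<phi> x (\<alpha> g)" for x g
  have "coordinates \<iota> \<xi> scale \<Delta> \<epsilon> S act \<psi>"
  proof
    fix x y assume eq: "\<psi> x = \<psi> y"
    have "\<phi> x \<eta> = \<phi> y \<eta>" for \<eta>
      using mem[of x] mem[of y] fun_cong[OF eq]
      by (cases "\<eta> \<in> ?N") (auto simp: \<psi>_def fixed_group_algebra_def group_algebra_def M)
    then show "x = y" using bij by (metis UNIV_I bij_betw_imp_inj_on ext inj_onD)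
  next
    fix f assume f: "\<And>\<gamma> g. \<gamma> \<in> carrier \<Gamma> \<Longrightarrow> f (g + \<xi> \<gamma> * g) = \<gamma> (f g)"
    let ?F = "\<lambda>\<eta>. if \<eta> \<in> ?N then f (inv_into UNIV \<alpha> \<eta>) else 0"
    have F: "?F (\<alpha> g) = f g" for g using inj_alpha by simp
    have "?F \<in> fixed_group_algebra \<iota> ?N"
      unfolding fixed_group_algebra_def group_algebra_def M mem_Collect_eq
    proof (intro conjI allI impI ballI)
      fix \<gamma> \<eta> assume g: "\<gamma> \<in> carrier \<Gamma>" and "\<eta> \<in> ?N"
      then obtain g where "\<eta> = \<alpha> g" by blast
      then show "?F (conj_left \<Gamma> \<gamma> \<eta>) = \<gamma> (?F \<eta>)"
        using F f[OF g] by (simp only: conj_alpha[OF g])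
    qed auto
    then have "?F \<in> range \<phi>" by (simp only: bij_betw_imp_surj_on[OF bij])
    then obtain x where x: "\<phi> x = ?F" by (elim rangeE) (rule that, rule HOL.sym)
    have "\<psi> x = f" by (rule ext) (simp only: \<psi>_def x F)
    then show "\<exists>x. \<psi> x = f" ..
  next
    fix \<gamma> x g assume g: "\<gamma> \<in> carrier \<Gamma>"
    show "\<psi> x (g + \<xi> \<gamma> * g) = \<gamma> (\<psi> x g)"
      using mem[of x] conj_alpha[OF g, symmetric] g
      by (auto simp: \<psi>_def fixed_group_algebra_def)
  next
    fix x y c g show "\<psi> (x + y) g = \<psi> x g + \<psi> y g" "\<psi> (scale c x) g = \<iota> c * \<psi> x g"
      using \<phi> by (auto simp: hopf_iso_onto_def \<psi>_def)
  next
    fix g show "\<psi> 1 g = (if g = 0 then 1 else 0)"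
      using \<phi> inj_alpha by (auto simp: hopf_iso_onto_def \<psi>_def ga_one_def M alpha_zero[symmetric] inj_eq)
  next
    fix x y g
    have pairs: "{(a, b). a \<in> ?N \<and> b \<in> ?N \<and> a \<otimes>\<^bsub>?M\<^esub> b = \<alpha> g} = (\<lambda>u. (\<alpha> u, \<alpha> (g - u))) ` UNIV"
      using inj_alpha by (auto simp: M alpha_mult inj_eq)
    have "inj (\<lambda>u. (\<alpha> u, \<alpha> (g - u)))" using inj_alpha by (auto simp: inj_def)
    note reindex = sum.reindex[OF this]
    have "\<phi> (x * y) = ga_mult ?M (\<phi> x) (\<phi> y)" using \<phi> by (simp add: hopf_iso_onto_def)
    then have "\<psi> (x * y) g
        = (\<Sum>(a, b)\<in>{(a, b). a \<in> ?N \<and> b \<in> ?N \<and> a \<otimes>\<^bsub>?M\<^esub> b = \<alpha> g}. \<phi> x a * \<phi> y b)"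
      by (simp add: \<psi>_def ga_mult_def M(1))
    also have "\<dots> = (\<Sum>u\<in>UNIV. \<psi> x u * \<psi> y (g - u))"
      unfolding pairs reindex by (simp add: \<psi>_def)
    finally show "\<psi> (x * y) g = (\<Sum>u\<in>UNIV. \<psi> x u * \<psi> y (g - u))" .
  next
    fix x g h show "(\<Sum>(a, b)\<leftarrow>\<Delta> x. \<psi> a g * \<psi> b h) = (if g = h then \<psi> x g else 0)"
      using comult[of "\<alpha> g" "\<alpha> h" x] inj_alpha by (simp add: \<psi>_def inj_eq)
  next
    fix x show "\<iota> (\<epsilon> x) = (\<Sum>g\<in>UNIV. \<psi> x g)"
      using \<phi> by (simp add: hopf_iso_onto_def \<psi>_def M sum_N)
  next
    fix x g show "\<psi> (S x) g = \<psi> x (- g)"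
      using \<phi> M_inv by (auto simp: hopf_iso_onto_def \<psi>_def M)
  next
    fix x z show "act x z = (\<Sum>g\<in>UNIV. \<psi> x g * \<theta> (- g) z)"
      by (simp add: act sum_N \<psi>_def alpha_inv alpha_at_one)
  qed
  then show ?thesis by (rule that)
qed

section \<open>Computing with formal sums of tensors\<close>

text \<open>
  The universal property of the tensor product: bilinear maps are well defined on tensors.
\<close>

lemma tensor_eq_bilinear:
  fixes B :: "'v::ab_group_add \<Rightarrow> 'w::ab_group_add \<Rightarrow> 'b::ab_group_add"
  assumes eq: "tensor_eq sV sW xs ys"
    and add1: "\<And>v v' w. B (v + v') w = B v w + B v' w"
    and add2: "\<And>v w w'. B v (w + w') = B v w + B v w'"
    and balanced: "\<And>c v w. B (sV c v) w = B v (sW c w)"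
  shows "(\<Sum>(v, w)\<leftarrow>xs. B v w) = (\<Sum>(v, w)\<leftarrow>ys. B v w)"
  using eq unfolding tensor_eq_def
proof (induction rule: formal_sum_cong.induct)
  case (base xs ys)
  then show ?case
  proof cases
    case (zero w)
    have "B 0 w = 0" using add1[of 0 0 w] by simp
    then show ?thesis by (simp add: zero)
  qed (simp_all add: add1 add2 balanced)
qed (simp_all add: add.commute)

lemma tensor_eq_refl: "tensor_eq sV sW xs xs"
  unfolding tensor_eq_def by (rule formal_sum_cong.refl)

lemma tensor_eq_sym: "tensor_eq sV sW xs ys \<Longrightarrow> tensor_eq sV sW ys xs"
  unfolding tensor_eq_def by (rule formal_sum_cong.sym)

lemma tensor_eq_trans [trans]:
  "tensor_eq sV sW xs ys \<Longrightarrow> tensor_eq sV sW ys zs \<Longrightarrow> tensor_eq sV sW xs zs"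
  unfolding tensor_eq_def by (rule formal_sum_cong.trans)

lemma tensor_eq_append:
  "tensor_eq sV sW xs ys \<Longrightarrow> tensor_eq sV sW us vs \<Longrightarrow> tensor_eq sV sW (xs @ us) (ys @ vs)"
  unfolding tensor_eq_def by (rule formal_sum_cong.append)

lemma tensor_eq_commute: "tensor_eq sV sW (xs @ ys) (ys @ xs)"
  unfolding tensor_eq_def by (rule formal_sum_cong.comm)

lemma
  shows tensor_eq_zero_left: "tensor_eq sV sW [(0, w)] []"
    and tensor_eq_add_left: "tensor_eq sV sW [(v + v', w)] [(v, w), (v', w)]"
    and tensor_eq_add_right: "tensor_eq sV sW [(v, w + w')] [(v, w), (v, w')]"
    and tensor_eq_balanced: "tensor_eq sV sW [(sV c v, w)] [(v, sW c w)]"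
  unfolding tensor_eq_def by (blast intro: formal_sum_cong.base bilinear_rel.intros)+

lemma tensor_eq_concat:
  assumes "\<And>m. m \<in> set ms \<Longrightarrow> tensor_eq sV sW (f m) (g m)"
  shows "tensor_eq sV sW (concat (map f ms)) (concat (map g ms))"
  using assms by (induction ms) (auto intro: tensor_eq_append tensor_eq_refl)

lemma concat_map_Nil: "concat (map (\<lambda>m. []) ms) = []"
  by (induction ms) auto

lemma tensor_eq_merge_right:
  "tensor_eq sV sW (map (\<lambda>m. (b m, u m)) ms @ map (\<lambda>m. (b m, v m)) ms)
     (map (\<lambda>m. (b m, u m + v m)) ms)"
proof (induction ms)
  case Nil
  show ?case by (simp add: tensor_eq_refl)
next
  case (Cons m ms)
  let ?U = "map (\<lambda>m. (b m, u m)) ms" and ?V = "map (\<lambda>m. (b m, v m)) ms"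
  have "tensor_eq sV sW ([(b m, u m)] @ (?U @ [(b m, v m)]) @ ?V)
      ([(b m, u m)] @ ([(b m, v m)] @ ?U) @ ?V)"
    by (intro tensor_eq_append tensor_eq_refl tensor_eq_commute)
  also have "[(b m, u m)] @ ([(b m, v m)] @ ?U) @ ?V = [(b m, u m), (b m, v m)] @ (?U @ ?V)" by simp
  also have "tensor_eq sV sW \<dots> ([(b m, u m + v m)] @ map (\<lambda>m. (b m, u m + v m)) ms)"
    by (intro tensor_eq_append Cons.IH tensor_eq_sym[OF tensor_eq_add_right])
  finally show ?case by simp
qed

context hopf_algebra
begin

lemma tensor_eq_zero_right: "tensor_eq scale scale [(v, 0)] []"
proof -
  have "tensor_eq scale scale [(v, scale 0 0)] [(scale 0 v, 0)]"
    by (rule tensor_eq_sym[OF tensor_eq_balanced])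
  also have "tensor_eq scale scale [(scale 0 v, 0)] []" by (simp add: tensor_eq_zero_left)
  finally show ?thesis by simp
qed

lemma tensor_eq_sum_left: "tensor_eq scale scale [(\<Sum>m\<leftarrow>ms. f m, w)] (map (\<lambda>m. (f m, w)) ms)"
proof (induction ms)
  case Nil
  show ?case by (simp add: tensor_eq_zero_left)
next
  case (Cons m ms)
  have "tensor_eq scale scale [(f m + (\<Sum>m\<leftarrow>ms. f m), w)] ([(f m, w)] @ [(\<Sum>m\<leftarrow>ms. f m, w)])"
    using tensor_eq_add_left by simp
  also have "tensor_eq scale scale \<dots> ([(f m, w)] @ map (\<lambda>m. (f m, w)) ms)"
    by (intro tensor_eq_append tensor_eq_refl Cons.IH)
  finally show ?case by simp
qed

text \<open>
  Expanding all left factors in the finite basis \<open>b\<close> and collecting terms brings a tensor into the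
  form \<open>\<Sum> b\<^sub>m \<otimes> w\<^sub>m\<close>.  This replaces a computation in \<open>H \<otimes> H\<close> by one with the vectors \<open>w\<^sub>m\<close> of \<open>H\<close>,
  which are determined by their coordinates.
\<close>

lemma tensor_eq_basis_expansion:
  assumes expand: "\<And>x. x = (\<Sum>m\<leftarrow>ms. scale (f x m) (b m))"
  shows "tensor_eq scale scale xs (map (\<lambda>m. (b m, \<Sum>(u, v)\<leftarrow>xs. scale (f u m) v)) ms)"
proof (induction xs)
  case Nil
  have "tensor_eq scale scale [] (concat (map (\<lambda>m. [(b m, 0)]) ms))"
    using tensor_eq_concat[OF tensor_eq_sym[OF tensor_eq_zero_right], of ms b]
    by (simp add: concat_map_Nil)
  then show ?case by simp
next
  case (Cons p xs)
  obtain u v where p: "p = (u, v)" by (cases p)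
  have "tensor_eq scale scale [(u, v)] (map (\<lambda>m. (scale (f u m) (b m), v)) ms)"
    using tensor_eq_sum_left[of "\<lambda>m. scale (f u m) (b m)" ms v] expand[of u] by simp
  also have "tensor_eq scale scale \<dots> (map (\<lambda>m. (b m, scale (f u m) v)) ms)"
    using tensor_eq_concat[of ms scale scale "\<lambda>m. [(scale (f u m) (b m), v)]"
        "\<lambda>m. [(b m, scale (f u m) v)]"]
    by (simp add: tensor_eq_balanced)
  finally have "tensor_eq scale scale ([p] @ xs)
      (map (\<lambda>m. (b m, scale (f u m) v)) ms @ map (\<lambda>m. (b m, \<Sum>(u, v)\<leftarrow>xs. scale (f u m) v)) ms)"
    unfolding p by (rule tensor_eq_append[OF _ Cons.IH])
  also have "tensor_eq scale scale \<dots>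
      (map (\<lambda>m. (b m, scale (f u m) v + (\<Sum>(u, v)\<leftarrow>xs. scale (f u m) v))) ms)"
    by (rule tensor_eq_merge_right)
  finally show ?case by (simp add: p)
qed

end

section \<open>Nilpotent rings and their circle groups\<close>

text \<open>
  From \<open>x = b x = b (b x) = \<dots>\<close> it follows that \<open>x\<close> lies in every power of the ring.
\<close>

lemma nilpotent_fixed_point:
  fixes b x :: "'a::comm_ring"
  assumes nil: "nilpotent_ring TYPE('a)" and fixed: "b * x = x"
  shows "x = 0"
proof -
  have mem: "x \<in> (ring_set_prod UNIV ^^ m) UNIV" for m
  proof (induction m)
    case (Suc m)
    then have "(\<Sum>(c, d)\<leftarrow>[(b, x)]. c * d) \<in> ring_set_prod UNIV ((ring_set_prod UNIV ^^ m) UNIV)"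
      unfolding ring_set_prod_def by (intro CollectI exI[of _ "[(b, x)]"]) auto
    then show ?case by (simp add: fixed)
  qed simp
  obtain n where "(ring_pow n :: 'a set) = {0}" using nil unfolding nilpotent_ring_def by blast
  then show ?thesis using mem[of "n - 1"] by (simp add: ring_pow_def)
qed

lemma ring_pow_2_trivial_iff: "(ring_pow 2 :: 'a::comm_ring set) = {0} \<longleftrightarrow> (\<forall>x y :: 'a. x * y = 0)"
proof
  assume z: "(ring_pow 2 :: 'a set) = {0}"
  show "\<forall>x y :: 'a. x * y = 0"
  proof (intro allI)
    fix x y :: 'a
    have "(\<Sum>(c, d)\<leftarrow>[(x, y)]. c * d) \<in> ring_set_prod UNIV UNIV"
      unfolding ring_set_prod_def by (intro CollectI exI[of _ "[(x, y)]"]) auto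
    then show "x * y = 0" using z by (simp add: ring_pow_def numeral_2_eq_2)
  qed
next
  assume z: "\<forall>x y :: 'a. x * y = 0"
  have "(\<Sum>(c, d)\<leftarrow>ps. c * d) = 0" for ps :: "('a \<times> 'a) list"
    using z by (induction ps) auto
  then have "ring_set_prod UNIV UNIV = {0 :: 'a}"
    unfolding ring_set_prod_def by (simp del: split_paired_All split_paired_Ex)
  then show "(ring_pow 2 :: 'a set) = {0}" by (simp add: ring_pow_def numeral_2_eq_2)
qed

lemma group_additive: "group (additive_group :: 'a::ab_group_add monoid)"
  by (rule groupI) (auto simp: additive_group_def add.assoc intro: exI[of _ "- x" for x])

lemma inv_additive: "inv\<^bsub>additive_group\<^esub> g = - (g :: 'a::ab_group_add)"
  by (rule group.inv_equality[OF group_additive]) (auto simp: additive_group_def)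

text \<open>
  A map \<open>z \<mapsto> x \<circ> z = x + z + x z\<close> that is a translation is the translation by its value \<open>x\<close> at \<open>0\<close>,
  and then \<open>x z = 0\<close> for all \<open>z\<close>.
\<close>

lemma ring_regular_subgroup_eq_translations_iff:
  "(ring_regular_subgroup :: ('a::comm_ring \<Rightarrow> 'a) set) = right_reg additive_group ` carrier additive_group
    \<longleftrightarrow> (\<forall>x y :: 'a. x * y = 0)"
proof -
  have l: "left_reg circle_group g = (\<lambda>x. g + x + g * x)" for g :: 'a
    by (auto simp: left_reg_def circle_group_def)
  have r: "right_reg additive_group g = (\<lambda>x. x - g)" for g :: 'a
    by (auto simp: right_reg_def inv_additive) (auto simp: additive_group_def)
  have T: "(ring_regular_subgroup :: ('a \<Rightarrow> 'a) set) = range (\<lambda>g x. g + x + g * x)"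
    by (simp add: ring_regular_subgroup_def l) (simp add: circle_group_def)
  have R: "right_reg additive_group ` carrier additive_group = range (\<lambda>g x :: 'a. x - g)"
    by (simp add: r) (simp add: additive_group_def)
  show ?thesis unfolding T R
  proof
    assume eq: "range (\<lambda>g x :: 'a. g + x + g * x) = range (\<lambda>g x. x - g)"
    show "\<forall>x y :: 'a. x * y = 0"
    proof (intro allI)
      fix x y :: 'a
      have "(\<lambda>z. x + z + x * z) \<in> range (\<lambda>g x. x - g)" using eq by blast
      then obtain g where g: "x + z + x * z = z - g" for z by (auto simp: fun_eq_iff)
      show "x * y = 0" using g[of 0] g[of y] by (simp add: algebra_simps)
    qed
  next
    assume z: "\<forall>x y :: 'a. x * y = 0"
    then have "(\<lambda>g x :: 'a. g + x + g * x) = (\<lambda>g x. x - g) \<circ> uminus" by (simp add: fun_eq_iff)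
    then have "range (\<lambda>g x :: 'a. g + x + g * x) = (\<lambda>g x. x - g) ` range uminus"
      by (simp only: image_comp)
    then show "range (\<lambda>g x :: 'a. g + x + g * x) = range (\<lambda>g x. x - g)"
      by (simp only: surj_uminus)
  qed
qed

section \<open>The trivial product and the classical structure\<close>

context coordinates
begin

lemma sum_neg_theta: "(\<Sum>g\<in>UNIV. f g (\<theta> (- g))) = (\<Sum>\<gamma>\<in>carrier \<Gamma>. f (- \<xi> \<gamma>) \<gamma>)"
proof (rule sum.reindex_bij_witness[of _ "\<lambda>\<gamma>. - \<xi> \<gamma>" "\<lambda>g. \<theta> (- g)"])
qed (auto simp: theta_in theta_xi)

text \<open>
  The action determines the coordinates: the automorphisms of \<open>L/K\<close> are linearly independent
  over \<open>L\<close>.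
\<close>

lemma act_unique:
  assumes "\<And>z. act x z = (\<Sum>\<gamma>\<in>carrier \<Gamma>. a \<gamma> * \<gamma> z)" and "\<gamma> \<in> carrier \<Gamma>"
  shows "\<psi> x (- \<xi> \<gamma>) = a \<gamma>"
proof -
  have "(\<Sum>\<gamma>\<in>carrier \<Gamma>. (\<psi> x (- \<xi> \<gamma>) - a \<gamma>) * \<gamma> z) = 0" for z
    using assms(1)[of z] coord_act[of x z] sum_neg_theta[of "\<lambda>g \<gamma>. \<psi> x g * \<gamma> z"]
    by (simp add: left_diff_distrib sum_subtractf)
  from linear_independence_of_automorphisms[OF this assms(2)] show ?thesis by simp
qed

text \<open>
  In the classical structure the automorphism \<open>\<theta>(- g)\<close> is the action of an element of \<open>H\<close>.  By
  \<open>act_unique\<close> this element has the coordinate \<open>1\<close> at \<open>g\<close> and \<open>0\<close> elsewhere.  Equivariance carries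
  its coordinate at \<open>g\<close> to the one at \<open>g + c g\<close>, which is therefore nonzero, so \<open>g + c g = g\<close>.
\<close>

theorem classical_imp_trivial:
  assumes "classical_structure \<iota> scale \<Delta> \<epsilon> S act"
  shows "c * g = (0 :: 'a)"
proof -
  interpret G: group \<Gamma> by (rule group_gal)
  obtain \<phi> where \<phi>: "hopf_iso_onto (\<lambda>c. c) scale \<Delta> \<epsilon> S \<Gamma> (group_algebra \<Gamma>) \<phi>"
    and act: "\<And>h z. act h z = (\<Sum>\<gamma>\<in>carrier \<Gamma>. \<iota> (\<phi> h \<gamma>) * \<gamma> z)"
    using assms unfolding classical_structure_def by blast
  have "(\<lambda>\<gamma>. if \<gamma> = \<theta> (- g) then 1 else 0) \<in> group_algebra \<Gamma>"
    using theta_in by (auto simp: group_algebra_def)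
  moreover have "range \<phi> = group_algebra \<Gamma>"
    using \<phi> by (simp add: hopf_iso_onto_def bij_betw_def)
  ultimately have "(\<lambda>\<gamma>. if \<gamma> = \<theta> (- g) then 1 else 0) \<in> range \<phi>" by simp
  then obtain h where h: "\<phi> h = (\<lambda>\<gamma>. if \<gamma> = \<theta> (- g) then 1 else 0)"
    by (elim rangeE) (rule that, rule HOL.sym)
  have coord: "\<psi> h u = (if u = g then 1 else 0)" for u
    using act_unique[OF act theta_in[of "- u"], of h] inj_theta
    by (auto simp: h base_one base_zero inj_eq)
  have "\<psi> h (g + \<xi> (\<theta> c) * g) = \<theta> c (\<psi> h g)" by (rule coord_equivariant[OF theta_in])
  then show ?thesis by (simp add: coord gal_one[OF theta_in] split: if_splits)
qed

text \<open>
  When all products vanish, equivariance says that the coefficients are fixed by \<open>\<Gamma>\<close>, hence in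
  \<open>K\<close>, and \<open>\<xi>\<close> is an isomorphism from \<open>\<Gamma>\<close> to the additive group.  The isomorphism from \<open>H\<close> to
  \<open>K[\<Gamma>]\<close> sends \<open>\<alpha>(g)\<close> to the automorphism \<open>\<theta>(- g)\<close> by which it acts; thus the coefficient at \<open>\<gamma>\<close>
  is the one of \<open>H\<close> at \<open>- \<xi>(\<gamma>)\<close>.
\<close>

theorem trivial_imp_classical:
  assumes trivial: "\<And>x y :: 'a. x * y = 0"
  shows "classical_structure \<iota> scale \<Delta> \<epsilon> S act"
proof -
  interpret G: group \<Gamma> by (rule group_gal)
  have "\<psi> x g \<in> range \<iota>" for x g
    using coord_equivariant[of _ x g, symmetric] by (intro fixed_in_base) (simp add: trivial)
  then have base: "\<iota> (inv_into UNIV \<iota> (\<psi> x g)) = \<psi> x g" for x g by (rule f_inv_into_f)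
  define \<phi> where "\<phi> x \<gamma> = (if \<gamma> \<in> carrier \<Gamma> then inv_into UNIV \<iota> (\<psi> x (- \<xi> \<gamma>)) else 0)" for x \<gamma>
  have \<phi>: "\<iota> (\<phi> x \<gamma>) = \<psi> x (- \<xi> \<gamma>)" if "\<gamma> \<in> carrier \<Gamma>" for x \<gamma>
    using that base by (simp add: \<phi>_def)
  have out: "\<phi> x \<gamma> = 0" if "\<gamma> \<notin> carrier \<Gamma>" for x \<gamma> using that by (simp add: \<phi>_def)
  have xi_hom: "\<xi> (\<gamma> \<otimes>\<^bsub>\<Gamma>\<^esub> \<delta>) = \<xi> \<gamma> + \<xi> \<delta>" if "\<gamma> \<in> carrier \<Gamma>" "\<delta> \<in> carrier \<Gamma>" for \<gamma> \<delta>
    using that by (simp add: xi_mult trivial)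
  have xi_inv: "\<xi> (inv\<^bsub>\<Gamma>\<^esub> \<gamma>) = - \<xi> \<gamma>" if "\<gamma> \<in> carrier \<Gamma>" for \<gamma>
    using xi_hom[OF G.inv_closed[OF that] that] that by (simp add: xi_one eq_neg_iff_add_eq_0)
  have ext: "f = g" if "\<And>\<gamma>. \<gamma> \<in> carrier \<Gamma> \<Longrightarrow> \<iota> (f \<gamma>) = \<iota> (g \<gamma>)"
    "\<And>\<gamma>. \<gamma> \<notin> carrier \<Gamma> \<Longrightarrow> f \<gamma> = g \<gamma>" for f g :: "('l \<Rightarrow> 'l) \<Rightarrow> 'k"
    using that base_inj by blast
  have "hopf_iso_onto (\<lambda>c. c) scale \<Delta> \<epsilon> S \<Gamma> (group_algebra \<Gamma>) \<phi>"
    unfolding hopf_iso_onto_def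
  proof (intro conjI allI ballI)
    have "inj \<phi>"
    proof (rule injI)
      fix x y assume eq: "\<phi> x = \<phi> y"
      have "\<psi> x g = \<psi> y g" for g
        using \<phi>[OF theta_in[of "- g"], of x] \<phi>[OF theta_in[of "- g"], of y] by (simp add: eq)
      then show "x = y" by (intro coord_inj HOL.ext)
    qed
    moreover have "f \<in> range \<phi>" if f: "f \<in> group_algebra \<Gamma>" for f
    proof -
      obtain x where x: "\<psi> x = (\<lambda>g. \<iota> (f (\<theta> (- g))))"
        using coord_surj[of "\<lambda>g. \<iota> (f (\<theta> (- g)))"] by (auto simp: trivial gal_base)
      have "\<phi> x = f"
        using f by (intro ext) (auto simp: \<phi> x theta_xi out group_algebra_def)
      then show ?thesis by blast
    qed
    ultimately show "bij_betw \<phi> UNIV (group_algebra \<Gamma>)"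
      using out by (auto simp: bij_betw_def group_algebra_def)
  next
    fix x y \<gamma> show "\<phi> (x + y) \<gamma> = \<phi> x \<gamma> + \<phi> y \<gamma>"
    proof (cases "\<gamma> \<in> carrier \<Gamma>")
      case True
      then show ?thesis using base_inj by (metis \<phi> base_add coord_add)
    qed (simp add: out)
  next
    fix c x \<gamma> show "\<phi> (scale c x) \<gamma> = c * \<phi> x \<gamma>"
    proof (cases "\<gamma> \<in> carrier \<Gamma>")
      case True
      then show ?thesis using base_inj by (metis \<phi> base_mult coord_scale)
    qed (simp add: out)
  next
    show "\<phi> 1 = ga_one \<Gamma>"
    proof (rule ext)
      fix \<gamma> assume g: "\<gamma> \<in> carrier \<Gamma>"
      then show "\<iota> (\<phi> 1 \<gamma>) = \<iota> (ga_one \<Gamma> \<gamma>)"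
        using xi_eq_iff[OF g G.one_closed]
        by (simp add: \<phi> coord_one ga_one_def xi_one base_one base_zero)
    next
      fix \<gamma> assume "\<gamma> \<notin> carrier \<Gamma>"
      then show "\<phi> 1 \<gamma> = ga_one \<Gamma> \<gamma>" using G.one_closed by (auto simp: out ga_one_def)
    qed
  next
    fix x y show "\<phi> (x * y) = ga_mult \<Gamma> (\<phi> x) (\<phi> y)"
    proof (rule ext)
      fix \<gamma> assume g: "\<gamma> \<in> carrier \<Gamma>"
      have "\<iota> (ga_mult \<Gamma> (\<phi> x) (\<phi> y) \<gamma>) =
          (\<Sum>(a, b)\<in>{(a, b). a \<in> carrier \<Gamma> \<and> b \<in> carrier \<Gamma> \<and> a \<otimes>\<^bsub>\<Gamma>\<^esub> b = \<gamma>}. \<psi> x (- \<xi> a) * \<psi> y (- \<xi> b))"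
        unfolding ga_mult_def base_sum by (rule sum.cong) (auto simp: base_mult \<phi>)
      also have "\<dots> = (\<Sum>u\<in>UNIV. \<psi> x u * \<psi> y (- \<xi> \<gamma> - u))"
      proof (rule sum.reindex_bij_witness[of _ "\<lambda>u. (\<theta> (- u), \<theta> (\<xi> \<gamma> + u))" "\<lambda>(a, b). - \<xi> a"])
        fix u :: 'a
        have "\<theta> (- u) \<otimes>\<^bsub>\<Gamma>\<^esub> \<theta> (\<xi> \<gamma> + u) = \<gamma>"
          by (rule xi_eq_iff[THEN iffD1]) (simp_all add: g theta_in xi_hom)
        then show "(\<theta> (- u), \<theta> (\<xi> \<gamma> + u)) \<in>
            {(a, b). a \<in> carrier \<Gamma> \<and> b \<in> carrier \<Gamma> \<and> a \<otimes>\<^bsub>\<Gamma>\<^esub> b = \<gamma>}"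
          by (simp add: theta_in)
      qed (auto simp: xi_hom theta_xi)
      also have "\<dots> = \<iota> (\<phi> (x * y) \<gamma>)" using g by (simp add: \<phi> coord_mult)
      finally show "\<iota> (\<phi> (x * y) \<gamma>) = \<iota> (ga_mult \<Gamma> (\<phi> x) (\<phi> y) \<gamma>)" by simp
    next
      fix \<gamma> assume g: "\<gamma> \<notin> carrier \<Gamma>"
      then have "{(a, b). a \<in> carrier \<Gamma> \<and> b \<in> carrier \<Gamma> \<and> a \<otimes>\<^bsub>\<Gamma>\<^esub> b = \<gamma>} = {}" by auto
      then show "\<phi> (x * y) \<gamma> = ga_mult \<Gamma> (\<phi> x) (\<phi> y) \<gamma>"
        unfolding ga_mult_def by (simp only: out[OF g] sum.empty)
    qed
  next
    fix x \<gamma> \<delta> assume g: "\<gamma> \<in> carrier \<Gamma>" "\<delta> \<in> carrier \<Gamma>"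
    have "\<iota> (\<Sum>(a, b)\<leftarrow>\<Delta> x. \<phi> a \<gamma> * \<phi> b \<delta>) = \<iota> (if \<gamma> = \<delta> then \<phi> x \<gamma> else 0)"
      using coord_comult[of "- \<xi> \<gamma>" "- \<xi> \<delta>" x] xi_eq_iff[OF g] g
      by (simp add: base_sum_list base_mult base_zero \<phi> case_prod_unfold)
    then show "(\<Sum>(a, b)\<leftarrow>\<Delta> x. \<phi> a \<gamma> * \<phi> b \<delta>) = (if \<gamma> = \<delta> then \<phi> x \<gamma> else 0)"
      by (simp only: base_inj)
  next
    fix x
    have "\<iota> (\<epsilon> x) = \<iota> (\<Sum>\<gamma>\<in>carrier \<Gamma>. \<phi> x \<gamma>)"
      unfolding base_sum coord_counit
      by (subst sum_neg_theta[of "\<lambda>g _. \<psi> x g"]) (simp add: \<phi>)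
    then show "\<epsilon> x = (\<Sum>\<gamma>\<in>carrier \<Gamma>. \<phi> x \<gamma>)" by (simp only: base_inj)
  next
    fix x \<gamma> assume g: "\<gamma> \<in> carrier \<Gamma>"
    have "\<iota> (\<phi> (S x) \<gamma>) = \<iota> (\<phi> x (inv\<^bsub>\<Gamma>\<^esub> \<gamma>))" using g by (simp add: \<phi> coord_antipode xi_inv)
    then show "\<phi> (S x) \<gamma> = \<phi> x (inv\<^bsub>\<Gamma>\<^esub> \<gamma>)" by (simp only: base_inj)
  qed
  moreover have "act x z = (\<Sum>\<gamma>\<in>carrier \<Gamma>. \<iota> (\<phi> x \<gamma>) * \<gamma> z)" for x z
    unfolding coord_act by (subst sum_neg_theta[of "\<lambda>g \<gamma>. \<psi> x g * \<gamma> z"]) (simp add: \<phi>)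
  ultimately show ?thesis unfolding classical_structure_def by blast
qed

end

section \<open>Sub-Hopf algebras and their fixed fields\<close>

context coordinates
begin

definition coord_support :: "'h set \<Rightarrow> 'a set" where
  "coord_support J = {g. \<exists>x\<in>J. \<psi> x g \<noteq> 0}"

text \<open>
  The \<open>L\<close>-span of \<open>J\<close> contains the group element at \<open>g\<close>.  If \<open>x \<in> J\<close> has a nonzero coefficient at
  \<open>g\<close>, write \<open>\<Delta>(x)\<close> as a sum of \<open>a \<otimes> b\<close> with entries in \<open>J\<close>.  Since group elements are grouplike,
  taking the coefficient at \<open>g\<close> in the left factors leaves \<open>\<psi> x g\<close> times the group element, and it
  exhibits this as an \<open>L\<close>-combination of the right factors.
\<close>

lemma support_delta:
  assumes J: "sub_hopf_algebra scale \<Delta> S J" and g: "g \<in> coord_support J"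
  obtains ys where "set ys \<subseteq> UNIV \<times> J"
    and "\<And>h. (\<Sum>(c, y)\<leftarrow>ys. c * \<psi> y h) = (if h = g then 1 else 0)"
proof -
  obtain x where x: "x \<in> J" "\<psi> x g \<noteq> 0" using g by (auto simp: coord_support_def)
  then obtain zs where zs: "set zs \<subseteq> J \<times> J" "tensor_eq scale scale (\<Delta> x) zs"
    using J unfolding sub_hopf_algebra_def by blast
  have coeff: "(\<Sum>(a, b)\<leftarrow>zs. \<psi> a g * \<psi> b h) = (if g = h then \<psi> x g else 0)" for h
    using tensor_eq_bilinear[OF zs(2), of "\<lambda>a b. \<psi> a g * \<psi> b h"]
    by (simp add: coord_comult coord_add coord_scale algebra_simps)
  let ?ys = "map (\<lambda>(a, b). (\<psi> a g / \<psi> x g, b)) zs"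
  have "(\<Sum>(c, y)\<leftarrow>?ys. c * \<psi> y h) = (\<Sum>(a, b)\<leftarrow>zs. \<psi> a g * \<psi> b h) / \<psi> x g" for h
    by (induction zs) (auto simp: add_divide_distrib)
  then have "(\<Sum>(c, y)\<leftarrow>?ys. c * \<psi> y h) = (if h = g then 1 else 0)" for h
    using coeff x(2) by simp
  moreover have "set ?ys \<subseteq> UNIV \<times> J" using zs(1) by auto
  ultimately show ?thesis by (rule that[rotated])
qed

lemma support_zero:
  assumes "sub_hopf_algebra scale \<Delta> S J"
  shows "0 \<in> coord_support J"
proof -
  have "1 \<in> J" "\<psi> 1 0 \<noteq> 0" using assms by (auto simp: sub_hopf_algebra_def coord_one)
  then show ?thesis unfolding coord_support_def by blast
qed

lemma support_uminus:
  assumes J: "sub_hopf_algebra scale \<Delta> S J" and g: "g \<in> coord_support J"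
  shows "- g \<in> coord_support J"
proof -
  obtain x where "x \<in> J" "\<psi> x g \<noteq> 0" using g by (auto simp: coord_support_def)
  then have "S x \<in> J" "\<psi> (S x) (- g) \<noteq> 0"
    using J by (auto simp: sub_hopf_algebra_def coord_antipode)
  then show ?thesis unfolding coord_support_def by blast
qed

text \<open>
  Multiplying \<open>x \<in> J\<close> by the group element at \<open>g\<close> moves its coefficient at \<open>h\<close> to \<open>g + h\<close>.  The
  group element is an \<open>L\<close>-combination of elements \<open>y \<in> J\<close>, so some product \<open>y x \<in> J\<close> has a nonzero
  coefficient at \<open>g + h\<close>.
\<close>

lemma support_add:
  assumes J: "sub_hopf_algebra scale \<Delta> S J"
    and g: "g \<in> coord_support J" and h: "h \<in> coord_support J"
  shows "g + h \<in> coord_support J"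
proof (rule ccontr)
  assume notin: "g + h \<notin> coord_support J"
  obtain ys where ys: "set ys \<subseteq> UNIV \<times> J"
    "\<And>u. (\<Sum>(c, y)\<leftarrow>ys. c * \<psi> y u) = (if u = g then 1 else 0)"
    using support_delta[OF J g] by blast
  obtain x where x: "x \<in> J" "\<psi> x h \<noteq> 0" using h by (auto simp: coord_support_def)
  have "\<psi> (y * x) (g + h) = 0" if "y \<in> J" for y
    using that x(1) J notin by (auto simp: sub_hopf_algebra_def coord_support_def)
  then have "(\<Sum>(c, y)\<leftarrow>ys. c * \<psi> (y * x) (g + h)) = 0"
    using ys(1) by (induction ys) auto
  moreover have "(\<Sum>(c, y)\<leftarrow>ys. c * \<psi> (y * x) (g + h))
      = (\<Sum>u\<in>UNIV. (\<Sum>(c, y)\<leftarrow>ys. c * \<psi> y u) * \<psi> x (g + h - u))"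
    by (induction ys) (auto simp: coord_mult sum_distrib_left distrib_right sum.distrib mult.assoc)
  moreover have "\<dots> = (\<Sum>u\<in>UNIV. if u = g then \<psi> x h else 0)"
    unfolding ys(2) by (rule sum.cong) auto
  ultimately show False using x(2) finite_ring by simp
qed

text \<open>
  By equivariance the coefficients at \<open>g\<close> and \<open>g + c g\<close> are conjugate under \<open>\<theta> c\<close>, so both are
  nonzero or both are zero; subtract \<open>g\<close>.
\<close>

lemma support_mult:
  assumes J: "sub_hopf_algebra scale \<Delta> S J" and g: "g \<in> coord_support J"
  shows "c * g \<in> coord_support J"
proof -
  obtain x where x: "x \<in> J" "\<psi> x g \<noteq> 0" using g by (auto simp: coord_support_def)
  have "\<psi> x (g + c * g) \<noteq> 0"
  proof
    assume "\<psi> x (g + c * g) = 0"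
    then have "\<theta> c (\<psi> x g) = \<theta> c 0"
      using coord_equivariant[OF theta_in, of x g c] by (simp add: gal_zero[OF theta_in])
    then show False using x(2) bij_is_inj[OF gal_bij[OF theta_in]] by (metis injD)
  qed
  then have "g + c * g \<in> coord_support J" using x(1) by (auto simp: coord_support_def)
  from support_add[OF J this support_uminus[OF J g]] show ?thesis by simp
qed

text \<open>
  An ideal of the ring is a subgroup of the circle group: its elements have circle products
  \<open>g + h + g h\<close> in the ideal, and the circle inverse \<open>d\<close> of \<open>g\<close> satisfies \<open>d = - (g + d g)\<close>.
\<close>

lemma subgroup_support:
  assumes J: "sub_hopf_algebra scale \<Delta> S J"
  shows "subgroup (\<theta> ` coord_support J) \<Gamma>"
proof (rule group.subgroupI[OF group_gal])
  interpret G: group \<Gamma> by (rule group_gal)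
  show "\<theta> ` coord_support J \<subseteq> carrier \<Gamma>" using theta_in by blast
  show "\<theta> ` coord_support J \<noteq> {}" using support_zero[OF J] by blast
  have in_image: "\<gamma> \<in> \<theta> ` coord_support J" if "\<gamma> \<in> carrier \<Gamma>" "\<xi> \<gamma> \<in> coord_support J" for \<gamma>
    using that theta_xi by (metis image_eqI)
  fix \<gamma> assume "\<gamma> \<in> \<theta> ` coord_support J"
  then obtain g where g: "\<gamma> = \<theta> g" "g \<in> coord_support J" by blast
  let ?d = "\<xi> (inv\<^bsub>\<Gamma>\<^esub> \<theta> g)"
  have "?d + g + ?d * g = 0"
    using xi_mult[OF G.inv_closed[OF theta_in] theta_in, of g g] by (simp add: theta_in xi_one)
  then have "?d = - (g + ?d * g)" by (simp only: eq_neg_iff_add_eq_0 add.assoc)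
  moreover have "- (g + ?d * g) \<in> coord_support J"
    by (intro support_uminus[OF J] support_add[OF J] support_mult[OF J] g(2))
  ultimately have "?d \<in> coord_support J" by simp
  then show "inv\<^bsub>\<Gamma>\<^esub> \<gamma> \<in> \<theta> ` coord_support J" using in_image theta_in g(1) by simp
  fix \<delta> assume "\<delta> \<in> \<theta> ` coord_support J"
  then obtain h where h: "\<delta> = \<theta> h" "h \<in> coord_support J" by blast
  have "g + h + g * h \<in> coord_support J"
    by (intro support_add[OF J] support_mult[OF J] g(2) h(2))
  then show "\<gamma> \<otimes>\<^bsub>\<Gamma>\<^esub> \<delta> \<in> \<theta> ` coord_support J"
    using in_image[of "\<gamma> \<otimes>\<^bsub>\<Gamma>\<^esub> \<delta>"] theta_in by (simp add: g(1) h(1) xi_mult)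
qed

text \<open>
  For fixed \<open>z\<close>, the defect \<open>y z - \<epsilon>(y) z\<close> is \<open>L\<close>-linear in the coordinates of \<open>y\<close>.  It therefore
  vanishes on \<open>J\<close> iff it vanishes on the \<open>L\<close>-span of \<open>J\<close>, which is spanned by the group elements in
  the support.
\<close>

theorem fixed_by_sub_hopf_algebra:
  assumes J: "sub_hopf_algebra scale \<Delta> S J"
  shows "fixed_by \<iota> \<epsilon> act J = fixed_field (\<theta> ` coord_support J)"
proof
  have defect: "act y z - \<iota> (\<epsilon> y) * z = (\<Sum>u\<in>UNIV. \<psi> y u * (\<theta> (- u) z - z))" for y z
    by (simp add: coord_act coord_counit sum_distrib_right right_diff_distrib sum_subtractf)
  show "fixed_by \<iota> \<epsilon> act J \<subseteq> fixed_field (\<theta> ` coord_support J)"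
  proof
    fix z assume z: "z \<in> fixed_by \<iota> \<epsilon> act J"
    have "\<theta> g z = z" if g: "g \<in> coord_support J" for g
    proof -
      obtain ys where ys: "set ys \<subseteq> UNIV \<times> J"
        "\<And>u. (\<Sum>(c, y)\<leftarrow>ys. c * \<psi> y u) = (if u = - g then 1 else 0)"
        using support_delta[OF J support_uminus[OF J g]] by blast
      have "0 = (\<Sum>(c, y)\<leftarrow>ys. c * (act y z - \<iota> (\<epsilon> y) * z))"
        using z ys(1) by (induction ys) (auto simp: fixed_by_def)
      also have "\<dots> = (\<Sum>u\<in>UNIV. (\<Sum>(c, y)\<leftarrow>ys. c * \<psi> y u) * (\<theta> (- u) z - z))"
        unfolding defect
        by (induction ys) (auto simp: sum_distrib_left distrib_right sum.distrib mult.assoc)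
      also have "\<dots> = (\<Sum>u\<in>UNIV. if u = - g then \<theta> g z - z else 0)"
        unfolding ys(2) by (rule sum.cong) auto
      finally show ?thesis using finite_ring by simp
    qed
    then show "z \<in> fixed_field (\<theta> ` coord_support J)" by (simp add: fixed_field_def)
  qed
  show "fixed_field (\<theta> ` coord_support J) \<subseteq> fixed_by \<iota> \<epsilon> act J"
  proof
    fix z assume z: "z \<in> fixed_field (\<theta> ` coord_support J)"
    have "act y z - \<iota> (\<epsilon> y) * z = 0" if "y \<in> J" for y
      unfolding defect
    proof (rule sum.neutral, rule ballI)
      fix u
      show "\<psi> y u * (\<theta> (- u) z - z) = 0"
      proof (cases "\<psi> y u = 0")
        case False
        then have "u \<in> coord_support J" using that by (auto simp: coord_support_def)
        then have "\<theta> (- u) z = z"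
          using z support_uminus[OF J] by (simp add: fixed_field_def)
        then show ?thesis by simp
      qed simp
    qed
    then show "z \<in> fixed_by \<iota> \<epsilon> act J" by (simp add: fixed_by_def)
  qed
qed

text \<open>
  The fixed field of the cyclic group generated by \<open>\<theta> x\<close> comes from some \<open>J\<close>, whose support \<open>I\<close> is an
  ideal that contains \<open>x\<close> and has at most \<open>p\<close> elements.  A nonzero \<open>a x \<in> I\<close> has additive order \<open>p\<close>
  and so generates \<open>I\<close>; in particular \<open>x\<close> is a multiple of \<open>a x\<close>, which contradicts nilpotency.
\<close>

theorem strong_FTGT_imp_trivial:
  assumes p: "Factorial_Ring.prime p"
    and gal: "elementary_abelian p \<Gamma>" and add: "elementary_abelian p (additive_group :: 'a monoid)"
    and nil: "nilpotent_ring TYPE('a)" and strong: "strong_FTGT \<iota> scale \<Delta> \<epsilon> S act"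
  shows "a * x = (0 :: 'a)"
proof (rule ccontr)
  interpret G: group \<Gamma> by (rule group_gal)
  interpret A: group "additive_group :: 'a monoid" by (rule group_additive)
  assume nonzero: "a * x \<noteq> 0"
  let ?D = "generate \<Gamma> {\<theta> x}"
  have subD: "subgroup ?D \<Gamma>" by (rule G.generate_is_subgroup) (simp add: theta_in)
  have "G.ord (\<theta> x) dvd p"
    using gal theta_in by (intro G.pow_eq_id[THEN iffD1]) (auto simp: elementary_abelian_def)
  then have card_D: "card ?D \<le> p"
    using G.generate_pow_card[OF theta_in, of x] prime_gt_0_nat[OF p] by (metis dvd_imp_le)
  obtain J where J: "sub_hopf_algebra scale \<Delta> S J" "fixed_by \<iota> \<epsilon> act J = fixed_field ?D"
    using strong intermediate_fixed_field[OF subgroup.subset[OF subD]]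
    unfolding strong_FTGT_def by blast
  let ?I = "coord_support J"
  \<comment> \<open>Both groups have the same fixed field, so they are equal.\<close>
  have D: "\<theta> ` ?I = ?D"
    using stabilizer_fixed_field[OF subgroup_support[OF J(1)]] stabilizer_fixed_field[OF subD]
      fixed_by_sub_hopf_algebra[OF J(1)] J(2) by simp
  have "\<theta> x \<in> \<theta> ` ?I" unfolding D by (rule generate.incl) simp
  then have x: "x \<in> ?I" using inj_theta by (metis inj_image_mem_iff)
  have card_I: "card ?I \<le> p"
    using card_D card_image[OF inj_on_subset[OF inj_theta], of ?I] D by simp
  let ?y = "a * x"
  let ?C = "generate additive_group {?y}"
  have y: "?y \<in> carrier additive_group" by (simp add: additive_group_def)
  have "A.ord ?y dvd p"
    using add y by (intro A.pow_eq_id[THEN iffD1]) (auto simp: elementary_abelian_def)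
  moreover have "A.ord ?y \<noteq> 1" using nonzero A.ord_eq_1[OF y] by (simp add: additive_group_def)
  ultimately have ord: "A.ord ?y = p" using p by (auto simp: prime_nat_iff)
  then have card_C: "card ?C = p" using A.generate_pow_card[OF y] by simp
  have pow: "?y [^]\<^bsub>additive_group\<^esub> (k::nat) \<in> ?I \<and> (\<exists>b. ?y [^]\<^bsub>additive_group\<^esub> k = b * x)" for k
  proof (induction k)
    case 0
    show ?case using support_zero[OF J(1)] by (auto simp: additive_group_def intro: exI[of _ 0])
  next
    case (Suc k)
    then obtain b where b: "?y [^]\<^bsub>additive_group\<^esub> k = b * x" by blast
    have "?y [^]\<^bsub>additive_group\<^esub> Suc k = ?y [^]\<^bsub>additive_group\<^esub> k + ?y"
      by (simp add: additive_group_def)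
    with b have "?y [^]\<^bsub>additive_group\<^esub> Suc k = (b + a) * x" by (simp add: distrib_right)
    then show ?case using support_mult[OF J(1) x] by metis
  qed
  have C: "?C = {?y [^]\<^bsub>additive_group\<^esub> k | k. k \<in> (UNIV :: nat set)}"
    by (rule A.generate_pow_nat[OF y]) (use ord prime_gt_0_nat[OF p] in simp)
  have "?C \<subseteq> ?I" unfolding C using pow by auto
  moreover have "finite ?I" by (rule finite_subset[OF subset_UNIV finite_ring])
  ultimately have "?C = ?I" using card_I card_C by (intro card_seteq) simp_all
  then have "x \<in> {?y [^]\<^bsub>additive_group\<^esub> k | k. k \<in> (UNIV :: nat set)}" using x unfolding C by simp
  then obtain k :: nat where k: "x = ?y [^]\<^bsub>additive_group\<^esub> k" by auto
  from pow[of k] obtain b where "?y [^]\<^bsub>additive_group\<^esub> k = b * x" by auto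
  then have "b * x = x" by (simp only: k[symmetric])
  then have "x = 0" by (rule nilpotent_fixed_point[OF nil])
  then show False using nonzero by simp
qed

end

section \<open>The Galois correspondence for the group algebra\<close>

context galois_extension
begin

text \<open>
  For an intermediate field with stabilizer \<open>D\<close> take \<open>J = K[D]\<close>, the elements whose coefficients
  vanish outside \<open>D\<close>.  Its fixed field is that of \<open>D\<close>, because it is spanned by the elements of \<open>D\<close>.
  That \<open>\<Delta>(x)\<close> lies in \<open>J \<otimes> J\<close> for \<open>x \<in> J\<close> requires an actual representation: expanding in the basis
  of group elements gives \<open>\<Sum> b\<^sub>\<gamma> \<otimes> x\<^sub>\<gamma> b\<^sub>\<gamma>\<close>, and the terms with \<open>\<gamma> \<notin> D\<close> are zero.
\<close>

theorem classical_imp_strong_FTGT: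
  assumes H: "hopf_algebra scale \<Delta> \<epsilon> S" and classical: "classical_structure \<iota> scale \<Delta> \<epsilon> S act"
  shows "strong_FTGT \<iota> scale \<Delta> \<epsilon> S act"
  unfolding strong_FTGT_def
proof (intro allI impI)
  interpret G: group \<Gamma> by (rule group_gal)
  interpret H: hopf_algebra scale \<Delta> \<epsilon> S by (rule H)
  obtain \<phi> where \<phi>: "hopf_iso_onto (\<lambda>c. c) scale \<Delta> \<epsilon> S \<Gamma> (group_algebra \<Gamma>) \<phi>"
    and act: "\<And>h z. act h z = (\<Sum>\<gamma>\<in>carrier \<Gamma>. \<iota> (\<phi> h \<gamma>) * \<gamma> z)"
    using classical unfolding classical_structure_def by blast
  have inj: "inj \<phi>" and range: "range \<phi> = group_algebra \<Gamma>"
    and add: "\<phi> (x + y) \<gamma> = \<phi> x \<gamma> + \<phi> y \<gamma>" and scale: "\<phi> (scale c x) \<gamma> = c * \<phi> x \<gamma>"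
    and one: "\<phi> 1 = ga_one \<Gamma>" and mult: "\<phi> (x * y) = ga_mult \<Gamma> (\<phi> x) (\<phi> y)"
    and counit: "\<iota> (\<epsilon> x) = (\<Sum>\<gamma>\<in>carrier \<Gamma>. \<iota> (\<phi> x \<gamma>))"
    for x y c \<gamma>
    using \<phi> by (auto simp: hopf_iso_onto_def bij_betw_def base_sum)
  have comult: "(\<Sum>(a, b)\<leftarrow>\<Delta> x. \<phi> a \<gamma> * \<phi> b \<delta>) = (if \<gamma> = \<delta> then \<phi> x \<gamma> else 0)"
    if "\<gamma> \<in> carrier \<Gamma>" "\<delta> \<in> carrier \<Gamma>" for x \<gamma> \<delta>
    using \<phi> that unfolding hopf_iso_onto_def by blast
  have antipode: "\<phi> (S x) \<gamma> = \<phi> x (inv\<^bsub>\<Gamma>\<^esub> \<gamma>)" if "\<gamma> \<in> carrier \<Gamma>" for x \<gamma>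
    using \<phi> that unfolding hopf_iso_onto_def by blast
  have out: "\<phi> x \<gamma> = 0" if "\<gamma> \<notin> carrier \<Gamma>" for x \<gamma>
    using range that by (auto simp: group_algebra_def)
  have zero: "\<phi> 0 \<gamma> = 0" for \<gamma> using scale[of 0 0 \<gamma>] by simp
  have sum_coord: "\<phi> (sum_list (map f ys)) \<gamma> = (\<Sum>y\<leftarrow>ys. \<phi> (f y) \<gamma>)" for f :: "'z \<Rightarrow> _" and ys \<gamma>
    by (induction ys) (simp_all add: zero add)
  \<comment> \<open>The element of \<open>H\<close> that corresponds to the group element \<open>\<gamma>\<close>.\<close>
  define b where "b \<gamma> = inv_into UNIV \<phi> (\<lambda>\<delta>. if \<delta> = \<gamma> then 1 else 0)" for \<gamma>
  have b: "\<phi> (b \<gamma>) = (\<lambda>\<delta>. if \<delta> = \<gamma> then 1 else 0)" if "\<gamma> \<in> carrier \<Gamma>" for \<gamma>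
    unfolding b_def by (rule f_inv_into_f) (use that range in \<open>auto simp: group_algebra_def\<close>)
  obtain ms where ms: "set ms = carrier \<Gamma>" "distinct ms"
    using finite_distinct_list[OF finite_gal] by blast
  have expand: "x = (\<Sum>\<gamma>\<leftarrow>ms. scale (\<phi> x \<gamma>) (b \<gamma>))" for x
  proof (rule injD[OF inj], rule HOL.ext)
    fix \<delta>
    have "\<phi> (\<Sum>\<gamma>\<leftarrow>ms. scale (\<phi> x \<gamma>) (b \<gamma>)) \<delta> = (\<Sum>\<gamma>\<in>carrier \<Gamma>. \<phi> x \<gamma> * \<phi> (b \<gamma>) \<delta>)"
      unfolding sum_coord scale by (simp only: sum_list_distinct_conv_sum_set[OF ms(2)] ms(1))
    also have "\<dots> = (\<Sum>\<gamma>\<in>carrier \<Gamma>. if \<gamma> = \<delta> then \<phi> x \<gamma> else 0)"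
      by (rule sum.cong) (auto simp: b)
    also have "\<dots> = \<phi> x \<delta>" using finite_gal out by simp
    finally show "\<phi> x \<delta> = \<phi> (\<Sum>\<gamma>\<leftarrow>ms. scale (\<phi> x \<gamma>) (b \<gamma>)) \<delta>" by simp
  qed
  fix E assume E: "intermediate_field \<iota> E"
  let ?D = "pointwise_stabilizer E"
  interpret D: subgroup ?D \<Gamma> by (rule subgroup_stabilizer)
  define J where "J = {x. \<forall>\<gamma>. \<gamma> \<notin> ?D \<longrightarrow> \<phi> x \<gamma> = 0}"
  have b_J: "b \<gamma> \<in> J" if "\<gamma> \<in> ?D" for \<gamma>
    using that D.subset by (auto simp: J_def b)
  have scale_J: "scale c x \<in> J" if "x \<in> J" for c x using that by (simp add: J_def scale)
  have comult_J: "\<exists>zs. set zs \<subseteq> J \<times> J \<and> tensor_eq scale scale (\<Delta> x) zs" if x: "x \<in> J" for x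
  proof -
    have coeff: "(\<Sum>(u, v)\<leftarrow>\<Delta> x. scale (\<phi> u \<gamma>) v) = scale (\<phi> x \<gamma>) (b \<gamma>)"
      if g: "\<gamma> \<in> carrier \<Gamma>" for \<gamma>
    proof (rule injD[OF inj], rule HOL.ext)
      fix \<delta>
      have "\<phi> (\<Sum>(u, v)\<leftarrow>\<Delta> x. scale (\<phi> u \<gamma>) v) \<delta> = (\<Sum>(u, v)\<leftarrow>\<Delta> x. \<phi> u \<gamma> * \<phi> v \<delta>)"
        by (simp add: sum_coord scale case_prod_unfold)
      also have "\<dots> = (if \<gamma> = \<delta> then \<phi> x \<gamma> else 0)"
      proof (cases "\<delta> \<in> carrier \<Gamma>")
        case False
        then show ?thesis using g by (auto simp: out case_prod_unfold)
      qed (rule comult[OF g])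
      also have "\<dots> = \<phi> (scale (\<phi> x \<gamma>) (b \<gamma>)) \<delta>"
        by (simp add: scale b[OF g])
      finally show "\<phi> (\<Sum>(u, v)\<leftarrow>\<Delta> x. scale (\<phi> u \<gamma>) v) \<delta> = \<phi> (scale (\<phi> x \<gamma>) (b \<gamma>)) \<delta>" .
    qed
    have "tensor_eq scale scale (\<Delta> x) (map (\<lambda>\<gamma>. (b \<gamma>, \<Sum>(u, v)\<leftarrow>\<Delta> x. scale (\<phi> u \<gamma>) v)) ms)"
      by (rule H.tensor_eq_basis_expansion) (rule expand)
    also have "map (\<lambda>\<gamma>. (b \<gamma>, \<Sum>(u, v)\<leftarrow>\<Delta> x. scale (\<phi> u \<gamma>) v)) ms
        = concat (map (\<lambda>\<gamma>. [(b \<gamma>, scale (\<phi> x \<gamma>) (b \<gamma>))]) ms)"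
      using ms(1) coeff by simp
    also have "tensor_eq scale scale \<dots>
        (concat (map (\<lambda>\<gamma>. if \<gamma> \<in> ?D then [(b \<gamma>, scale (\<phi> x \<gamma>) (b \<gamma>))] else []) ms))"
      using x by (intro tensor_eq_concat) (auto simp: J_def tensor_eq_refl H.tensor_eq_zero_right)
    finally have "tensor_eq scale scale (\<Delta> x)
        (concat (map (\<lambda>\<gamma>. if \<gamma> \<in> ?D then [(b \<gamma>, scale (\<phi> x \<gamma>) (b \<gamma>))] else []) ms))" .
    moreover have "set (concat (map (\<lambda>\<gamma>. if \<gamma> \<in> ?D then [(b \<gamma>, scale (\<phi> x \<gamma>) (b \<gamma>))] else []) ms))
        \<subseteq> J \<times> J"
      by (auto simp: b_J scale_J split: if_splits)
    ultimately show ?thesis by blast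
  qed
  have "sub_hopf_algebra scale \<Delta> S J"
    unfolding sub_hopf_algebra_def
  proof (intro conjI ballI)
    show "H.subspace J" by (rule H.subspaceI) (auto simp: J_def zero add scale)
    show "1 \<in> J" by (auto simp: J_def one ga_one_def)
    show "x * y \<in> J" if "x \<in> J" "y \<in> J" for x y
    proof -
      have "\<phi> x u * \<phi> y v = 0" if "u \<otimes>\<^bsub>\<Gamma>\<^esub> v \<notin> ?D" for u v
        using that \<open>x \<in> J\<close> \<open>y \<in> J\<close> D.m_closed by (auto simp: J_def)
      then show ?thesis
        by (auto simp: J_def mult ga_mult_def intro!: sum.neutral)
    qed
    show "S x \<in> J" if x: "x \<in> J" for x
      unfolding J_def
    proof (intro CollectI allI impI)
      fix \<gamma> assume g: "\<gamma> \<notin> ?D"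
      show "\<phi> (S x) \<gamma> = 0"
      proof (cases "\<gamma> \<in> carrier \<Gamma>")
        case True
        then have "inv\<^bsub>\<Gamma>\<^esub> \<gamma> \<notin> ?D" using g D.m_inv_closed by (metis G.inv_inv)
        then show ?thesis using x antipode[OF True] by (simp add: J_def)
      qed (rule out)
    qed
  qed (rule comult_J)
  moreover have "fixed_by \<iota> \<epsilon> act J = fixed_field ?D"
  proof
    have counit_b: "\<iota> (\<epsilon> (b \<gamma>)) = 1" and act_b: "act (b \<gamma>) z = \<gamma> z"
      if g: "\<gamma> \<in> carrier \<Gamma>" for \<gamma> z
    proof -
      have "(\<Sum>\<delta>\<in>carrier \<Gamma>. \<iota> (\<phi> (b \<gamma>) \<delta>)) = (\<Sum>\<delta>\<in>carrier \<Gamma>. if \<delta> = \<gamma> then 1 else 0)"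
        by (rule sum.cong) (auto simp: b g base_one base_zero)
      then show "\<iota> (\<epsilon> (b \<gamma>)) = 1" using g finite_gal by (simp add: counit)
      have "act (b \<gamma>) z = (\<Sum>\<delta>\<in>carrier \<Gamma>. if \<delta> = \<gamma> then \<gamma> z else 0)"
        unfolding act by (rule sum.cong) (auto simp: b g base_one base_zero)
      then show "act (b \<gamma>) z = \<gamma> z" using g finite_gal by simp
    qed
    show "fixed_by \<iota> \<epsilon> act J \<subseteq> fixed_field ?D"
    proof
      fix z assume z: "z \<in> fixed_by \<iota> \<epsilon> act J"
      have "\<gamma> z = z" if "\<gamma> \<in> ?D" for \<gamma>
      proof -
        have g: "\<gamma> \<in> carrier \<Gamma>" using that D.subset by blast
        have "act (b \<gamma>) z = \<iota> (\<epsilon> (b \<gamma>)) * z" using z b_J[OF that] by (simp add: fixed_by_def)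
        then show ?thesis by (simp add: counit_b[OF g] act_b[OF g])
      qed
      then show "z \<in> fixed_field ?D" by (simp add: fixed_field_def)
    qed
    show "fixed_field ?D \<subseteq> fixed_by \<iota> \<epsilon> act J"
    proof
      fix z assume z: "z \<in> fixed_field ?D"
      have "act x z = \<iota> (\<epsilon> x) * z" if "x \<in> J" for x
        unfolding act counit sum_distrib_right
      proof (rule sum.cong[OF HOL.refl])
        fix \<gamma>
        show "\<iota> (\<phi> x \<gamma>) * \<gamma> z = \<iota> (\<phi> x \<gamma>) * z"
          using that z by (cases "\<gamma> \<in> ?D") (auto simp: J_def fixed_field_def base_zero)
      qed
      then show "z \<in> fixed_by \<iota> \<epsilon> act J" by (simp add: fixed_by_def)
    qed
  qed
  ultimately show "\<exists>J. sub_hopf_algebra scale \<Delta> S J \<and> fixed_by \<iota> \<epsilon> act J = E"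
    using fixed_field_stabilizer[OF E] by metis
qed

end

theorem theorem4p1:
  fixes \<iota> :: "'k::field \<Rightarrow> 'l::field"
    and scale :: "'k \<Rightarrow> 'h \<Rightarrow> 'h::ring_1"
    and \<Delta> :: "'h \<Rightarrow> ('h \<times> 'h) list"
    and \<epsilon> :: "'h \<Rightarrow> 'k"
    and S :: "'h \<Rightarrow> 'h"
    and act :: "'h \<Rightarrow> 'l \<Rightarrow> 'l"
    and T :: "('a::comm_ring \<Rightarrow> 'a) set"
    and p n :: nat
  assumes "Factorial_Ring.prime p"
    and "finite_galois_ext \<iota>"
    and "elementary_abelian p (gal_group \<iota>)"
    and "card (carrier (gal_group \<iota>)) = p ^ n"
    and "hopf_galois \<iota> scale \<Delta> \<epsilon> S act"
    and "\<forall>x y :: 'h. x * y = y * x"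
    and "elementary_abelian p (additive_group :: 'a monoid)"
    and "has_type \<iota> scale \<Delta> \<epsilon> S act (additive_group :: 'a monoid)"
    and "nilpotent_ring TYPE('a)"
    and "T = ring_regular_subgroup"
    and "corresponds_to_ring \<iota> scale \<Delta> \<epsilon> S act TYPE('a)"
  shows "(strong_FTGT \<iota> scale \<Delta> \<epsilon> S act \<longleftrightarrow> (ring_pow 2 :: 'a set) = {0}) \<and>
    ((ring_pow 2 :: 'a set) = {0} \<longleftrightarrow>
      T = right_reg additive_group ` carrier additive_group) \<and>
    (T = right_reg additive_group ` carrier additive_group \<longleftrightarrow>
      classical_structure \<iota> scale \<Delta> \<epsilon> S act)"
proof -
  have H: "hopf_algebra scale \<Delta> \<epsilon> S" using assms(5) by (simp add: hopf_galois_def)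
  interpret galois_extension \<iota>
    using assms(2,3) by unfold_locales (auto simp: elementary_abelian_def)
  obtain \<xi> :: "('l \<Rightarrow> 'l) \<Rightarrow> 'a" where \<xi>: "\<xi> \<in> iso (gal_group \<iota>) circle_group"
    and corr: "corresponds_to_subgroup \<iota> scale \<Delta> \<epsilon> S act (range (perm_embedding (gal_group \<iota>) \<xi>))"
    using assms(11) unfolding corresponds_to_ring_def by blast
  interpret circle_isomorphism \<iota> \<xi> by unfold_locales (rule \<xi>)
  obtain \<psi> where "coordinates \<iota> \<xi> scale \<Delta> \<epsilon> S act \<psi>"
    using coordinates_of_correspondence[OF H corr] .
  then interpret coordinates \<iota> \<xi> scale \<Delta> \<epsilon> S act \<psi> .
  let ?trivial = "\<forall>x y :: 'a. x * y = 0"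
  have "strong_FTGT \<iota> scale \<Delta> \<epsilon> S act \<Longrightarrow> ?trivial"
    using strong_FTGT_imp_trivial[OF assms(1,3,7,9)] by blast
  moreover have "?trivial \<Longrightarrow> classical_structure \<iota> scale \<Delta> \<epsilon> S act"
    using trivial_imp_classical by blast
  moreover have "classical_structure \<iota> scale \<Delta> \<epsilon> S act \<Longrightarrow> ?trivial"
    using classical_imp_trivial by blast
  moreover have "classical_structure \<iota> scale \<Delta> \<epsilon> S act \<Longrightarrow> strong_FTGT \<iota> scale \<Delta> \<epsilon> S act"
    using classical_imp_strong_FTGT[OF H] .
  ultimately show ?thesis
    using ring_pow_2_trivial_iff[where 'a='a] ring_regular_subgroup_eq_translations_iff[where 'a='a]
    unfolding assms(10) by blast
qed

end
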